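(* Let $e_1,e_2,e_3$ be the standard basis of $\mathbb{R}^3$ and let $K$ be the convex hull of $\{e_1,e_2,e_3\}$. Let $x_i=(e_i+e_1+e_2+e_3)/4$ for $i=1,2,3$ and $y=(e_1+e_2+e_3)/3$. Set $$\mu=\frac13\sum_{i=1}^3\delta_{x_i}\quad\text{and}\quad \nu_t=t\,\delta_y+\frac{1-t}{3}\sum_{i=1}^3\delta_{e_i}\quad\text{for }0\le t\le1.$$ Then, for $t \in [0,1]$, $\mu\prec_c\nu_t$ if and only if $0\le t\le\frac34$, whereas $\mu\prec_d\nu_t$ if and only if $0\le t\le 0.9$.
   Context: $\delta_x$ is the point mass at $x$. $\mathrm{C}(K)$ is the C*-algebra of continuous complex-valued functions on $K$, $A(K)\subset\mathrm{C}(K)$ is the space of continuous affine functions, and $M^+(K)$ is the set of (finite) positive regular Borel measures on $K$. Choquet order: $\mu\prec_c\nu$ if $\int f\,d\mu\le\int f\,d\nu$ for every continuous convex (real-valued) function $f$ on $K$. Dilation order: a representation of $\mu\in M^+(K)$ is a tuple $(\pi,H,\xi)$ with $\pi:\mathrm{C}(K)\to\mathcal{B}(H)$ a $*$-representation on a Hilbert space $H$ and $\xi\in H$ such that $\int_K f\,d\mu=\langle\pi(f)\xi,\xi\rangle$ for all $f\in\mathrm{C}(K)$. A representation $(\pi,H,\xi)$ of $\mu$ is dilated by a representation $(\sigma,L,\eta)$ of $\nu$ if there is an isometry $V:H\to L$ with $\pi(a)=V^*\sigma(a)V$ for all $a\in A(K)$ and $\eta=V\xi$. Then $\mu\prec_d\nu$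 if some representation of $\mu$ is dilated by a representation of $\nu$. *)

theory Defs
  imports "HOL-Analysis.Analysis" "HOL-Probability.Giry_Monad" "HOL-Algebra.Module"
begin

section \<open>Complex Hilbert spaces\<close>

text \<open>
  Hilbert spaces are modules over the field of complex numbers in the sense of HOL-Algebra, so
  that the underlying set is a carrier inside a type and one can quantify existentially over
  Hilbert spaces. The inner product is linear in the first argument.
\<close>

definition complex_field :: "complex ring" where
  "complex_field = \<lparr>carrier = UNIV, mult = (*), one = 1, zero = 0, add = (+)\<rparr>"

record 'h prehilbert = "(complex, 'h) module" +
  cinner :: "'h \<Rightarrow> 'h \<Rightarrow> complex"

definition hnorm :: "'h prehilbert \<Rightarrow> 'h \<Rightarrow> real" where
  "hnorm H u = sqrt (Re (cinner H u u))"

locale hilbert_space = Module.module complex_field H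
  for H :: "'h prehilbert" +
  assumes cinner_add: "\<lbrakk>u \<in> carrier H; v \<in> carrier H; w \<in> carrier H\<rbrakk>
      \<Longrightarrow> cinner H (u \<oplus>\<^bsub>H\<^esub> v) w = cinner H u w + cinner H v w"
    and cinner_smult: "\<lbrakk>u \<in> carrier H; w \<in> carrier H\<rbrakk>
      \<Longrightarrow> cinner H (c \<odot>\<^bsub>H\<^esub> u) w = c * cinner H u w"
    and cinner_commute: "\<lbrakk>u \<in> carrier H; w \<in> carrier H\<rbrakk>
      \<Longrightarrow> cinner H u w = cnj (cinner H w u)"
    and cinner_nonneg: "u \<in> carrier H \<Longrightarrow> 0 \<le> Re (cinner H u u)"
    and cinner_definite: "\<lbrakk>u \<in> carrier H; cinner H u u = 0\<rbrakk> \<Longrightarrow> u = \<zero>\<^bsub>H\<^esub>"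
    and complete: "Metric_space.mcomplete (carrier H) (\<lambda>u v. hnorm H (u \<ominus>\<^bsub>H\<^esub> v))"

definition linear_operator :: "'h prehilbert \<Rightarrow> 'l prehilbert \<Rightarrow> ('h \<Rightarrow> 'l) \<Rightarrow> bool" where
  "linear_operator H L T \<longleftrightarrow>
     (\<forall>u\<in>carrier H. T u \<in> carrier L) \<and>
     (\<forall>u\<in>carrier H. \<forall>v\<in>carrier H. T (u \<oplus>\<^bsub>H\<^esub> v) = T u \<oplus>\<^bsub>L\<^esub> T v) \<and>
     (\<forall>c. \<forall>u\<in>carrier H. T (c \<odot>\<^bsub>H\<^esub> u) = c \<odot>\<^bsub>L\<^esub> T u)"

definition bounded_operator :: "'h prehilbert \<Rightarrow> 'l prehilbert \<Rightarrow> ('h \<Rightarrow> 'l) \<Rightarrow> bool" where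
  "bounded_operator H L T \<longleftrightarrow>
     linear_operator H L T \<and> (\<exists>C. \<forall>u\<in>carrier H. hnorm L (T u) \<le> C * hnorm H u)"

definition isometry_operator :: "'h prehilbert \<Rightarrow> 'l prehilbert \<Rightarrow> ('h \<Rightarrow> 'l) \<Rightarrow> bool" where
  "isometry_operator H L V \<longleftrightarrow>
     linear_operator H L V \<and> (\<forall>u\<in>carrier H. hnorm L (V u) = hnorm H u)"

definition is_adjoint ::
    "'h prehilbert \<Rightarrow> 'l prehilbert \<Rightarrow> ('h \<Rightarrow> 'l) \<Rightarrow> ('l \<Rightarrow> 'h) \<Rightarrow> bool" where
  "is_adjoint H L T S \<longleftrightarrow>
     bounded_operator L H S \<and>
     (\<forall>u\<in>carrier H. \<forall>v\<in>carrier L. cinner L (T u) v = cinner H u (S v))"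


section \<open>Function spaces and representations\<close>

text \<open>
  Elements of \<open>C(K)\<close> and \<open>A(K)\<close> are represented by total functions whose values outside \<open>K\<close> are
  irrelevant; the first condition of \<open>star_representation\<close> says that \<open>\<pi>\<close> only depends on the
  restriction to \<open>K\<close>.
\<close>

definition cont_fun :: "'a::topological_space set \<Rightarrow> ('a \<Rightarrow> complex) set" where
  "cont_fun K = {f. continuous_on K f}"

definition affine_fun :: "'a::real_normed_vector set \<Rightarrow> ('a \<Rightarrow> complex) set" where
  "affine_fun K = {f \<in> cont_fun K. \<forall>x\<in>K. \<forall>y\<in>K. \<forall>s\<in>{0..1}.
     f ((1 - s) *\<^sub>R x + s *\<^sub>R y) = (1 - s) *\<^sub>R f x + s *\<^sub>R f y}"

definition star_representation ::
    "'a::topological_space set \<Rightarrow> 'h prehilbert \<Rightarrow> (('a \<Rightarrow> complex) \<Rightarrow> 'h \<Rightarrow> 'h) \<Rightarrow> bool" where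
  "star_representation K H \<pi> \<longleftrightarrow>
     (\<forall>f\<in>cont_fun K. \<forall>g\<in>cont_fun K. (\<forall>x\<in>K. f x = g x) \<longrightarrow>
        (\<forall>u\<in>carrier H. \<pi> f u = \<pi> g u)) \<and>
     (\<forall>f\<in>cont_fun K. bounded_operator H H (\<pi> f)) \<and>
     (\<forall>f\<in>cont_fun K. \<forall>g\<in>cont_fun K. \<forall>u\<in>carrier H.
        \<pi> (\<lambda>x. f x + g x) u = \<pi> f u \<oplus>\<^bsub>H\<^esub> \<pi> g u) \<and>
     (\<forall>c. \<forall>f\<in>cont_fun K. \<forall>u\<in>carrier H. \<pi> (\<lambda>x. c * f x) u = c \<odot>\<^bsub>H\<^esub> \<pi> f u) \<and>
     (\<forall>f\<in>cont_fun K. \<forall>g\<in>cont_fun K. \<forall>u\<in>carrier H.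
        \<pi> (\<lambda>x. f x * g x) u = \<pi> f (\<pi> g u)) \<and>
     (\<forall>f\<in>cont_fun K. is_adjoint H H (\<pi> f) (\<pi> (\<lambda>x. cnj (f x))))"


section \<open>Measures and the two orders\<close>

text \<open>
  Measures on \<open>K\<close> live on the Borel sigma-algebra of the subspace \<open>K\<close>.
\<close>

definition pos_measures :: "'a::topological_space set \<Rightarrow> 'a measure set" where
  "pos_measures K = {\<mu>. finite_measure \<mu> \<and>
     space \<mu> = K \<and> sets \<mu> = sets (restrict_space borel K) \<and>
     (\<forall>A\<in>sets \<mu>.
        emeasure \<mu> A = (SUP C\<in>{C. compact C \<and> C \<subseteq> A}. emeasure \<mu> C) \<and>
        emeasure \<mu> A = (INF U\<in>{U. openin (top_of_set K) U \<and> A \<subseteq> U}. emeasure \<mu> U))}"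

definition choquet_le ::
    "'a::real_normed_vector set \<Rightarrow> 'a measure \<Rightarrow> 'a measure \<Rightarrow> bool" where
  "choquet_le K \<mu> \<nu> \<longleftrightarrow> \<mu> \<in> pos_measures K \<and> \<nu> \<in> pos_measures K \<and>
     (\<forall>f::'a \<Rightarrow> real. continuous_on K f \<and> convex_on K f \<longrightarrow>
        (\<integral>x. f x \<partial>\<mu>) \<le> (\<integral>x. f x \<partial>\<nu>))"

definition representation ::
    "'a::topological_space set \<Rightarrow> 'a measure \<Rightarrow>
     (('a \<Rightarrow> complex) \<Rightarrow> 'h \<Rightarrow> 'h) \<Rightarrow> 'h prehilbert \<Rightarrow> 'h \<Rightarrow> bool" where
  "representation K \<mu> \<pi> H \<xi> \<longleftrightarrow>
     hilbert_space H \<and> star_representation K H \<pi> \<and> \<xi> \<in> carrier H \<and>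
     (\<forall>f\<in>cont_fun K. (\<integral>x. f x \<partial>\<mu>) = cinner H (\<pi> f \<xi>) \<xi>)"

definition dilated_by ::
    "'a::real_normed_vector set \<Rightarrow>
     (('a \<Rightarrow> complex) \<Rightarrow> 'h \<Rightarrow> 'h) \<Rightarrow> 'h prehilbert \<Rightarrow> 'h \<Rightarrow>
     (('a \<Rightarrow> complex) \<Rightarrow> 'l \<Rightarrow> 'l) \<Rightarrow> 'l prehilbert \<Rightarrow> 'l \<Rightarrow> bool" where
  "dilated_by K \<pi> H \<xi> \<sigma> L \<eta> \<longleftrightarrow>
     (\<exists>V W. isometry_operator H L V \<and> is_adjoint H L V W \<and>
        (\<forall>a\<in>affine_fun K. \<forall>u\<in>carrier H. \<pi> a u = W (\<sigma> a (V u))) \<and>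
        \<eta> = V \<xi>)"

text \<open>
  HOL cannot quantify over types inside a formula, so the type \<open>'h\<close> containing the underlying
  sets of the Hilbert spaces is a parameter, playing the role of a universe. It has to be large
  enough to contain nonzero Hilbert spaces; every type of the form \<open>'i \<Rightarrow> complex\<close> has at least
  the cardinality of the continuum, hence contains a copy of every separable Hilbert space, and
  every Hilbert space has a copy in such a type for a suitable \<open>'i\<close>.
\<close>

definition dilation_le ::
    "'h itself \<Rightarrow> 'a::real_normed_vector set \<Rightarrow> 'a measure \<Rightarrow> 'a measure \<Rightarrow> bool" where
  "dilation_le _ K \<mu> \<nu> \<longleftrightarrow> \<mu> \<in> pos_measures K \<and> \<nu> \<in> pos_measures K \<and>
     (\<exists>\<pi> (H :: 'h prehilbert) \<xi> \<sigma> (L :: 'h prehilbert) \<eta>.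
        representation K \<mu> \<pi> H \<xi> \<and> representation K \<nu> \<sigma> L \<eta> \<and>
        dilated_by K \<pi> H \<xi> \<sigma> L \<eta>)"


section \<open>The measures on the triangle\<close>

definition point_mass :: "'a::topological_space set \<Rightarrow> 'a \<Rightarrow> 'a measure" where
  "point_mass K x = return (restrict_space borel K) x"

definition add_measure :: "'a measure \<Rightarrow> 'a measure \<Rightarrow> 'a measure" where
  "add_measure M N = measure_of (space M) (sets M) (\<lambda>A. emeasure M A + emeasure N A)"

lemma space_add_measure [simp]: "space (add_measure M N) = space M"
  by (simp add: add_measure_def)

lemma sets_add_measure [simp]: "sets (add_measure M N) = sets M"
  by (simp add: add_measure_def)

lemma emeasure_add_measure:
  assumes "sets N = sets M" "A \<in> sets M"
  shows "emeasure (add_measure M N) A = emeasure M A + emeasure N A"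
proof (rule emeasure_measure_of[OF add_measure_def sets.space_closed])
  show "A \<in> sets (add_measure M N)" using assms by simp
  show "positive (sets (add_measure M N)) (\<lambda>A. emeasure M A + emeasure N A)"
    by (simp add: positive_def)
  show "countably_additive (sets (add_measure M N)) (\<lambda>A. emeasure M A + emeasure N A)"
    using assms(1) by (auto simp: countably_additive_def suminf_add[symmetric] suminf_emeasure)
qed

definition vertex :: "3 \<Rightarrow> real^3" where
  "vertex i = axis i 1"

definition std_triangle :: "(real^3) set" where
  "std_triangle = convex hull {vertex 1, vertex 2, vertex 3}"

definition inner_pt :: "3 \<Rightarrow> real^3" where
  "inner_pt i = (1/4) *\<^sub>R (vertex i + vertex 1 + vertex 2 + vertex 3)"

definition barycenter :: "real^3" where
  "barycenter = (1/3) *\<^sub>R (vertex 1 + vertex 2 + vertex 3)"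

definition sum_point_masses :: "(3 \<Rightarrow> real^3) \<Rightarrow> (real^3) measure" where
  "sum_point_masses z = add_measure (add_measure
     (point_mass std_triangle (z 1)) (point_mass std_triangle (z 2))) (point_mass std_triangle (z 3))"

definition mu :: "(real^3) measure" where
  "mu = scale_measure (ennreal (1/3)) (sum_point_masses inner_pt)"

definition nu :: "real \<Rightarrow> (real^3) measure" where
  "nu t = add_measure (scale_measure (ennreal t) (point_mass std_triangle barycenter))
     (scale_measure (ennreal ((1 - t) / 3)) (sum_point_masses vertex))"

end

theory Submission
  imports Defs
begin

text \<open>
  Write \<open>a\<^sub>1, a\<^sub>2, a\<^sub>3\<close> for the barycentric coordinates on the triangle. The question is how much
  mass the barycentre \<open>y\<close> can receive when \<open>\<mu>\<close> is spread out over \<open>y\<close> and the vertices. The dilation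
  order allows more, because it splits positive matrices where the Choquet order splits positive
  numbers.

  For the Choquet order, \<open>x\<^sub>i = (e\<^sub>i + 3y)/4\<close> exhibits \<open>\<nu>\<^sub>t\<close> with \<open>t = 3/4\<close> as a dilation of \<open>\<mu>\<close> by kernels,
  and the convex function \<open>max a\<^sub>1 a\<^sub>2 a\<^sub>3\<close> shows that no larger \<open>t\<close> is possible
  (lemma \<open>choquet_le_mu_nu_iff\<close>).

  For the dilation order, let \<open>C(K)\<close> act on \<open>\<complex>\<^sup>3\<close> by evaluation at \<open>x\<^sub>1, x\<^sub>2, x\<^sub>3\<close>, with the unit vector
  \<open>\<xi>\<close> that has equal entries. A dilation supported on \<open>y, e\<^sub>1, e\<^sub>2, e\<^sub>3\<close> amounts to positive
  \<open>3 \<times> 3\<close> matrices \<open>Q\<^sub>y, Q\<^sub>1, Q\<^sub>2, Q\<^sub>3\<close> such that \<open>Q\<^sub>y/3 + Q\<^sub>j\<close> is the diagonal matrix \<open>A\<^sub>j\<close> of the numbers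
  \<open>a\<^sub>j(x\<^sub>i)\<close>, and the weight of the new measure at an atom is the expectation at \<open>\<xi>\<close> of the matrix
  there. With \<open>Q\<^sub>y = t\<xi>\<xi>\<^sup>*\<close>, the weights are those of \<open>\<nu>\<^sub>t\<close>, and \<open>Q\<^sub>j = A\<^sub>j - (t/9)E\<close>, where \<open>E\<close> is the
  all-ones matrix. This is positive if and only if \<open>t/9\<close> times the sum \<open>2 + 4 + 4\<close> of the inverse diagonal
  entries of \<open>A\<^sub>j\<close> is at most \<open>1\<close>, that is, if \<open>t \<le> 9/10\<close>. An explicit square root of \<open>Q\<^sub>j\<close> then gives the
  isometry (lemmas \<open>rank_one_square_root\<close>, \<open>dilation_matrix_compress\<close>,
  \<open>dilation_le_mu_nu_if_le_nine_tenths\<close>).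

  That no other pair of representations does better follows from a dual certificate, valid in every
  dilation: a sum of three nonnegative quantities \<open>\<langle>\<sigma>(a\<^sub>j)q\<^sub>j, q\<^sub>j\<rangle>\<close>, with polynomial
  choices of the vectors \<open>q\<^sub>j\<close>, evaluates to \<open>5/2 - 25t/9\<close>
  (lemma \<open>dilation_imp_le_nine_tenths\<close>).
\<close>

section \<open>Finitely supported measures\<close>

definition discrete_measure ::
    "'a::topological_space set \<Rightarrow> ('k::finite \<Rightarrow> 'a) \<Rightarrow> ('k \<Rightarrow> real) \<Rightarrow> 'a measure" where
  "discrete_measure K p w =
     distr (point_measure UNIV (\<lambda>k. ennreal (w k))) (restrict_space borel K) p"

lemma space_discrete_measure [simp]: "space (discrete_measure K p w) = K"
  and sets_discrete_measure [simp]: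
    "sets (discrete_measure K p w) = sets (restrict_space borel K)"
  by (simp_all add: discrete_measure_def space_restrict_space)

lemma emeasure_discrete_measure:
  assumes "range p \<subseteq> K" "A \<in> sets (restrict_space borel K)"
  shows "emeasure (discrete_measure K p w) A = (\<Sum>k\<in>UNIV. ennreal (w k) * indicator A (p k))"
proof -
  have "p \<in> measurable (point_measure UNIV (\<lambda>k. ennreal (w k))) (restrict_space borel K)"
    using assms(1) by (auto simp: space_restrict_space)
  then have "emeasure (discrete_measure K p w) A = (\<Sum>k\<in>p -` A. ennreal (w k))"
    using assms(2)
    by (simp add: discrete_measure_def emeasure_distr space_point_measure
        emeasure_point_measure_finite)
  also have "\<dots> = (\<Sum>k\<in>UNIV. ennreal (w k) * indicator A (p k))"
    by (intro sum.mono_neutral_cong_left) (auto simp: indicator_def)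
  finally show ?thesis .
qed

lemma integral_discrete_measure:
  fixes f :: "'a::topological_space \<Rightarrow> 'b::{banach, second_countable_topology}"
  assumes "range p \<subseteq> K" "\<And>k. 0 \<le> w k" "continuous_on K f"
  shows "integral\<^sup>L (discrete_measure K p w) f = (\<Sum>k\<in>UNIV. w k *\<^sub>R f (p k))"
proof -
  have "p \<in> measurable (point_measure UNIV (\<lambda>k. ennreal (w k))) (restrict_space borel K)"
    using assms(1) by (auto simp: space_restrict_space)
  moreover have "f \<in> borel_measurable (restrict_space borel K)"
    using assms(3) by (rule borel_measurable_continuous_on_restrict)
  ultimately show ?thesis
    using assms(2)
    by (simp add: discrete_measure_def integral_distr lebesgue_integral_point_measure_finite)
qed

text \<open>
  Intersecting with the finite set of atoms gives a compact set of full measure inside any Borel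
  set, and removing the finitely many atoms outside a Borel set from \<open>K\<close> gives a relatively open
  set of the same measure around it; so the supremum and the infimum are attained.
\<close>

lemma discrete_measure_in_pos_measures:
  fixes p :: "'k::finite \<Rightarrow> 'a::t1_space"
  assumes p: "range p \<subseteq> K"
  shows "discrete_measure K p w \<in> pos_measures K"
proof -
  let ?M = "discrete_measure K p w" and ?R = "sets (restrict_space borel K)"
  have fin: "C \<in> ?R" if "finite C" "C \<subseteq> K" for C
    using that unfolding sets_restrict_space
    by (intro image_eqI[of _ _ C] borel_closed finite_imp_closed) auto
  have op: "U \<in> ?R" if "openin (top_of_set K) U" for U
  proof -
    from that obtain T where "open T" "U = K \<inter> T"
      unfolding openin_open by blast
    then show ?thesis
      unfolding sets_restrict_space by (intro image_eqI[of _ _ T]) (auto intro: borel_open)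
  qed
  have eq: "emeasure ?M A = emeasure ?M B"
    if "A \<in> ?R" "B \<in> ?R" "A \<inter> range p = B \<inter> range p" for A B
  proof -
    have "p k \<in> A \<longleftrightarrow> p k \<in> B" for k
      using that(3) by blast
    then show ?thesis
      using that(1,2) by (simp add: emeasure_discrete_measure[OF p] indicator_def)
  qed
  have K: "K \<in> ?R"
    using sets.top[of ?M] by simp
  have "finite_measure ?M"
    by standard (simp add: emeasure_discrete_measure[OF p K] ennreal_mult_eq_top_iff indicator_def)
  moreover have "emeasure ?M A = (SUP C\<in>{C. compact C \<and> C \<subseteq> A}. emeasure ?M C)"
    and "emeasure ?M A = (INF U\<in>{U. openin (top_of_set K) U \<and> A \<subseteq> U}. emeasure ?M U)"
    if A: "A \<in> ?R" for A
  proof -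
    have AK: "A \<subseteq> K"
      using sets.sets_into_space[of A ?M] A by simp
    have "A \<inter> range p \<in> ?R"
      using AK by (intro fin) auto
    then have "emeasure ?M A = emeasure ?M (A \<inter> range p)"
      using A by (intro eq) auto
    then have "emeasure ?M A \<le> (SUP C\<in>{C. compact C \<and> C \<subseteq> A}. emeasure ?M C)"
      by (auto intro!: SUP_upper finite_imp_compact)
    moreover have "(SUP C\<in>{C. compact C \<and> C \<subseteq> A}. emeasure ?M C) \<le> emeasure ?M A"
      using A by (intro SUP_least) (auto intro: emeasure_mono)
    ultimately show "emeasure ?M A = (SUP C\<in>{C. compact C \<and> C \<subseteq> A}. emeasure ?M C)"
      by (rule antisym)
    let ?U = "K - (range p - A)"
    have U: "openin (top_of_set K) ?U"
      by (auto simp: Diff_eq openin_open finite_imp_closed intro!: exI[of _ "- (range p - A)"])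
    moreover have "emeasure ?M A = emeasure ?M ?U"
      using p by (intro eq A op[OF U]) auto
    ultimately have "(INF U\<in>{U. openin (top_of_set K) U \<and> A \<subseteq> U}. emeasure ?M U) \<le> emeasure ?M A"
      using AK by (auto intro!: INF_lower2[of ?U])
    moreover have "emeasure ?M A \<le> (INF U\<in>{U. openin (top_of_set K) U \<and> A \<subseteq> U}. emeasure ?M U)"
      by (intro INF_greatest emeasure_mono) (auto simp: op)
    ultimately show "emeasure ?M A = (INF U\<in>{U. openin (top_of_set K) U \<and> A \<subseteq> U}. emeasure ?M U)"
      by (rule antisym[rotated])
  qed
  ultimately show ?thesis
    unfolding pos_measures_def by (simp add: space_restrict_space)
qed

section \<open>The triangle and the two measures\<close>

lemma vertex_nth: "vertex i $ j = (if j = i then 1 else 0)"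
  by (simp add: vertex_def axis_def)

lemma barycenter_nth: "barycenter $ j = 1/3"
  using exhaust_3[of j] by (auto simp: barycenter_def vertex_nth)

lemma inner_pt_eq: "inner_pt i = (1/4) *\<^sub>R vertex i + (3/4) *\<^sub>R barycenter"
  by (simp add: inner_pt_def barycenter_def algebra_simps)

lemma inner_pt_nth: "inner_pt i $ j = (if j = i then 1/2 else 1/4)"
  by (simp add: inner_pt_eq vertex_nth barycenter_nth)

lemma convex_std_triangle: "convex std_triangle"
  by (simp add: std_triangle_def)

lemma vertex_in_std_triangle: "vertex i \<in> std_triangle"
  unfolding std_triangle_def using exhaust_3[of i] by (auto intro: hull_inc)

lemma barycenter_in_std_triangle: "barycenter \<in> std_triangle"
proof -
  have "barycenter = (\<Sum>i\<in>UNIV. (1/3) *\<^sub>R vertex i)"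
    by (simp add: barycenter_def sum_3 scaleR_add_right)
  also have "\<dots> \<in> std_triangle"
    by (intro convex_sum convex_std_triangle) (auto simp: vertex_in_std_triangle)
  finally show ?thesis .
qed

lemma inner_pt_in_std_triangle: "inner_pt i \<in> std_triangle"
  unfolding inner_pt_eq
  by (intro convexD[OF convex_std_triangle] vertex_in_std_triangle barycenter_in_std_triangle) auto

lemma std_triangle_coordinates:
  assumes "x \<in> std_triangle"
  shows "0 \<le> x $ j" "x $ 1 + x $ 2 + x $ 3 = 1"
proof -
  have "std_triangle \<subseteq> {x. (\<forall>j. 0 \<le> x $ j) \<and> x $ 1 + x $ 2 + x $ 3 = 1}" (is "_ \<subseteq> ?S")
    unfolding std_triangle_def
  proof (rule hull_minimal)
    show "convex ?S"
    proof (rule convexI)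
      fix x y :: "real^3" and u v :: real
      assume *: "x \<in> ?S" "y \<in> ?S" "0 \<le> u" "0 \<le> v" "u + v = 1"
      have "(u *\<^sub>R x + v *\<^sub>R y) $ 1 + (u *\<^sub>R x + v *\<^sub>R y) $ 2 + (u *\<^sub>R x + v *\<^sub>R y) $ 3
          = u * (x $ 1 + x $ 2 + x $ 3) + v * (y $ 1 + y $ 2 + y $ 3)"
        by (simp add: algebra_simps)
      with * show "u *\<^sub>R x + v *\<^sub>R y \<in> ?S"
        by simp
    qed
  qed (auto simp: vertex_nth)
  then show "0 \<le> x $ j" "x $ 1 + x $ 2 + x $ 3 = 1"
    using assms by auto
qed

text \<open>
  The four atoms of \<open>\<nu>\<^sub>t\<close>: \<open>None\<close> stands for the barycentre and \<open>Some j\<close> for the \<open>j\<close>-th vertex.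
\<close>

definition nu_point :: "3 option \<Rightarrow> real^3" where
  "nu_point k = (case k of None \<Rightarrow> barycenter | Some j \<Rightarrow> vertex j)"

definition nu_weight :: "real \<Rightarrow> 3 option \<Rightarrow> real" where
  "nu_weight t k = (case k of None \<Rightarrow> t | Some j \<Rightarrow> (1 - t) / 3)"

lemma nu_point_simps [simp]: "nu_point None = barycenter" "nu_point (Some j) = vertex j"
  by (simp_all add: nu_point_def)

lemma sum_option:
  fixes f :: "'k::finite option \<Rightarrow> 'b::comm_monoid_add"
  shows "(\<Sum>k\<in>UNIV. f k) = f None + (\<Sum>j\<in>UNIV. f (Some j))"
  by (simp add: UNIV_option_conv sum.reindex)

lemma range_nu_point: "range nu_point \<subseteq> std_triangle"
  by (auto simp: nu_point_def barycenter_in_std_triangle vertex_in_std_triangle split: option.split)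

lemma range_inner_pt: "range inner_pt \<subseteq> std_triangle"
  by (auto simp: inner_pt_in_std_triangle)

lemma sets_point_mass: "sets (point_mass K x) = sets (restrict_space borel K)"
  by (simp add: point_mass_def)

lemma sets_sum_point_masses: "sets (sum_point_masses z) = sets (restrict_space borel std_triangle)"
  by (simp add: sum_point_masses_def sets_point_mass)

lemma emeasure_sum_point_masses:
  assumes "A \<in> sets (restrict_space borel std_triangle)"
  shows "emeasure (sum_point_masses z) A = (\<Sum>i\<in>UNIV. indicator A (z i))"
  using assms
  by (simp add: sum_point_masses_def emeasure_add_measure sets_point_mass sum_3)
     (simp add: point_mass_def)

lemma mu_eq_discrete_measure: "mu = discrete_measure std_triangle inner_pt (\<lambda>_. 1/3)"
proof (rule measure_eqI)
  fix A assume "A \<in> sets mu"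
  then have "A \<in> sets (restrict_space borel std_triangle)"
    by (simp add: mu_def sets_sum_point_masses)
  then show "emeasure mu A = emeasure (discrete_measure std_triangle inner_pt (\<lambda>_. 1/3)) A"
    by (simp add: mu_def emeasure_sum_point_masses sum_distrib_left
        emeasure_discrete_measure[OF range_inner_pt])
qed (simp add: mu_def sets_sum_point_masses)

lemma nu_eq_discrete_measure: "nu t = discrete_measure std_triangle nu_point (nu_weight t)"
proof (rule measure_eqI)
  fix A assume "A \<in> sets (nu t)"
  then have A: "A \<in> sets (restrict_space borel std_triangle)"
    by (simp add: nu_def sets_point_mass)
  then have "emeasure (point_mass std_triangle barycenter) A = indicator A barycenter"
    by (simp add: point_mass_def)
  with A show "emeasure (nu t) A = emeasure (discrete_measure std_triangle nu_point (nu_weight t)) A"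
    by (simp add: nu_def emeasure_add_measure sets_point_mass sets_sum_point_masses
        emeasure_sum_point_masses emeasure_discrete_measure[OF range_nu_point] nu_weight_def sum_option
        sum_distrib_left)
qed (simp add: nu_def sets_point_mass)

lemma mu_in_pos_measures: "mu \<in> pos_measures std_triangle"
  unfolding mu_eq_discrete_measure by (rule discrete_measure_in_pos_measures[OF range_inner_pt])

lemma nu_in_pos_measures: "nu t \<in> pos_measures std_triangle"
  unfolding nu_eq_discrete_measure by (rule discrete_measure_in_pos_measures[OF range_nu_point])

lemma integral_mu:
  fixes f :: "real^3 \<Rightarrow> 'b::{banach, second_countable_topology}"
  assumes "continuous_on std_triangle f"
  shows "integral\<^sup>L mu f = (1/3) *\<^sub>R (\<Sum>i\<in>UNIV. f (inner_pt i))"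
  using integral_discrete_measure[OF range_inner_pt _ assms, of "\<lambda>_. 1/3"]
  by (simp add: mu_eq_discrete_measure scaleR_sum_right)

lemma integral_nu:
  fixes f :: "real^3 \<Rightarrow> 'b::{banach, second_countable_topology}"
  assumes "t \<in> {0..1}" "continuous_on std_triangle f"
  shows "integral\<^sup>L (nu t) f = t *\<^sub>R f barycenter + ((1 - t) / 3) *\<^sub>R (\<Sum>j\<in>UNIV. f (vertex j))"
proof -
  have "0 \<le> nu_weight t k" for k
    using assms(1) by (auto simp: nu_weight_def split: option.split)
  then have "integral\<^sup>L (nu t) f = (\<Sum>k\<in>UNIV. nu_weight t k *\<^sub>R f (nu_point k))"
    unfolding nu_eq_discrete_measure
    by (intro integral_discrete_measure range_nu_point assms(2))
  then show ?thesis
    by (simp add: sum_option nu_weight_def scaleR_sum_right)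
qed

section \<open>The Choquet order\<close>

text \<open>
  The largest barycentric coordinate is a convex function with integral \<open>1/2\<close> against \<open>\<mu>\<close> and
  \<open>1 - 2t/3\<close> against \<open>\<nu>\<^sub>t\<close>, which forces \<open>t \<le> 3/4\<close>. In the other direction \<open>\<nu>\<^sub>3\<^sub>/\<^sub>4\<close> arises
  from \<open>\<mu>\<close> by splitting each \<open>x\<^sub>i = (e\<^sub>i + 3y)/4\<close> into \<open>e\<^sub>i\<close> and \<open>y\<close>, and smaller \<open>t\<close> moves mass
  from \<open>y\<close> to the vertices, whose barycentre is \<open>y\<close>.
\<close>

lemma choquet_le_mu_nu_iff:
  assumes t: "t \<in> {0..1}"
  shows "choquet_le std_triangle mu (nu t) \<longleftrightarrow> t \<le> 3/4"
proof
  assume le: "choquet_le std_triangle mu (nu t)"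
  let ?f = "\<lambda>x::real^3. max (x $ 1) (max (x $ 2) (x $ 3))"
  have cont: "continuous_on std_triangle ?f"
    by (intro continuous_intros)
  have "convex_on std_triangle ?f"
  proof (rule convex_onI)
    fix s :: real and x y :: "real^3" assume "0 < s" "s < 1"
    have "((1 - s) *\<^sub>R x + s *\<^sub>R y) $ j \<le> (1 - s) * ?f x + s * ?f y" for j
    proof -
      have "z $ j \<le> ?f z" for z
        using exhaust_3[of j] by auto
      with \<open>0 < s\<close> \<open>s < 1\<close> have "(1 - s) * x $ j + s * y $ j \<le> (1 - s) * ?f x + s * ?f y"
        by (intro add_mono mult_left_mono) auto
      then show ?thesis
        by simp
    qed
    then show "?f ((1 - s) *\<^sub>R x + s *\<^sub>R y) \<le> (1 - s) * ?f x + s * ?f y"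
      by (intro max.boundedI)
  qed (rule convex_std_triangle)
  with cont le have "integral\<^sup>L mu ?f \<le> integral\<^sup>L (nu t) ?f"
    by (auto simp: choquet_le_def)
  then show "t \<le> 3/4"
    by (simp add: integral_mu[OF cont] integral_nu[OF t cont] sum_3 inner_pt_nth vertex_nth
        barycenter_nth field_simps)
next
  assume t': "t \<le> 3/4"
  show "choquet_le std_triangle mu (nu t)"
    unfolding choquet_le_def
  proof (intro conjI allI impI mu_in_pos_measures nu_in_pos_measures)
    fix f :: "real^3 \<Rightarrow> real"
    assume "continuous_on std_triangle f \<and> convex_on std_triangle f"
    then have cont: "continuous_on std_triangle f" and conv: "convex_on std_triangle f"
      by auto
    have inner: "f (inner_pt i) \<le> 1/4 * f (vertex i) + 3/4 * f barycenter" for i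
      using convex_onD[OF conv, of "3/4" "vertex i" barycenter]
      by (simp add: inner_pt_eq vertex_in_std_triangle barycenter_in_std_triangle)
    have "f (\<Sum>i\<in>UNIV. (1/3) *\<^sub>R vertex i) \<le> (\<Sum>i\<in>UNIV. (1/3) * f (vertex i))"
      by (intro convex_on_sum[OF _ _ conv]) (auto simp: vertex_in_std_triangle)
    moreover have "(\<Sum>i\<in>UNIV. (1/3) *\<^sub>R vertex i) = barycenter"
      by (simp add: barycenter_def sum_3 scaleR_add_right)
    ultimately have bary: "f barycenter \<le> 1/3 * (\<Sum>i\<in>UNIV. f (vertex i))"
      by (simp add: sum_distrib_left)
    have "(3/4 - t) * f barycenter \<le> (3/4 - t) * (1/3 * (\<Sum>i\<in>UNIV. f (vertex i)))"
      using t' bary by (intro mult_left_mono) auto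
    moreover have "(\<Sum>i\<in>UNIV. f (inner_pt i)) \<le> (\<Sum>i\<in>UNIV. 1/4 * f (vertex i) + 3/4 * f barycenter)"
      by (intro sum_mono inner)
    ultimately show "integral\<^sup>L mu f \<le> integral\<^sup>L (nu t) f"
      by (simp add: integral_mu[OF cont] integral_nu[OF t cont] sum_3 field_simps)
  qed
qed

section \<open>Representations and their compressions\<close>

lemma complex_field_simps [simp]:
  "carrier complex_field = UNIV" "zero complex_field = 0" "one complex_field = 1"
  "add complex_field = (+)" "mult complex_field = (*)"
  by (simp_all add: complex_field_def)

context hilbert_space
begin

lemma cinner_add_right:
  assumes "u \<in> carrier H" "v \<in> carrier H" "w \<in> carrier H"
  shows "cinner H w (u \<oplus>\<^bsub>H\<^esub> v) = cinner H w u + cinner H w v"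
  using assms cinner_commute[of w] by (simp add: cinner_add)

lemma cinner_zero_left: "w \<in> carrier H \<Longrightarrow> cinner H \<zero>\<^bsub>H\<^esub> w = 0"
  using cinner_smult[of "\<zero>\<^bsub>H\<^esub>" w 0] by simp

end

lemma star_representationD:
  assumes "star_representation K H \<pi>" "u \<in> carrier H" "continuous_on K f"
  shows star_representation_closed: "\<pi> f u \<in> carrier H"
    and star_representation_cong:
      "continuous_on K g \<Longrightarrow> (\<And>x. x \<in> K \<Longrightarrow> f x = g x) \<Longrightarrow> \<pi> f u = \<pi> g u"
    and star_representation_add:
      "continuous_on K g \<Longrightarrow> \<pi> (\<lambda>x. f x + g x) u = \<pi> f u \<oplus>\<^bsub>H\<^esub> \<pi> g u"
    and star_representation_smult: "\<pi> (\<lambda>x. c * f x) u = c \<odot>\<^bsub>H\<^esub> \<pi> f u"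
    and star_representation_mult: "continuous_on K g \<Longrightarrow> \<pi> (\<lambda>x. f x * g x) u = \<pi> f (\<pi> g u)"
    and star_representation_add_vector:
      "v \<in> carrier H \<Longrightarrow> \<pi> f (u \<oplus>\<^bsub>H\<^esub> v) = \<pi> f u \<oplus>\<^bsub>H\<^esub> \<pi> f v"
    and star_representation_smult_vector: "\<pi> f (c \<odot>\<^bsub>H\<^esub> u) = c \<odot>\<^bsub>H\<^esub> \<pi> f u"
    and star_representation_adjoint:
      "v \<in> carrier H \<Longrightarrow> cinner H (\<pi> f u) v = cinner H u (\<pi> (\<lambda>x. cnj (f x)) v)"
proof -
  note def = assms(1)[unfolded star_representation_def cont_fun_def]
  note cong = def[THEN conjunct1] and def = def[THEN conjunct2]
  note bounded = def[THEN conjunct1] and def = def[THEN conjunct2]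
  note add = def[THEN conjunct1] and def = def[THEN conjunct2]
  note smult = def[THEN conjunct1] and def = def[THEN conjunct2]
  note mult = def[THEN conjunct1] and adjoint = def[THEN conjunct2]
  have linear: "linear_operator H H (\<pi> f)"
    using bounded assms(3) by (simp add: bounded_operator_def)
  show "\<pi> f u \<in> carrier H" "\<pi> f (c \<odot>\<^bsub>H\<^esub> u) = c \<odot>\<^bsub>H\<^esub> \<pi> f u"
    using linear assms(2) by (simp_all add: linear_operator_def)
  show "\<pi> f (u \<oplus>\<^bsub>H\<^esub> v) = \<pi> f u \<oplus>\<^bsub>H\<^esub> \<pi> f v" if "v \<in> carrier H"
    using linear assms(2) that by (simp add: linear_operator_def)
  show "\<pi> (\<lambda>x. c * f x) u = c \<odot>\<^bsub>H\<^esub> \<pi> f u"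
    using smult assms(2,3) by simp
  show "\<pi> f u = \<pi> g u" if "continuous_on K g" "\<And>x. x \<in> K \<Longrightarrow> f x = g x"
    using cong assms(2,3) that by blast
  show "\<pi> (\<lambda>x. f x + g x) u = \<pi> f u \<oplus>\<^bsub>H\<^esub> \<pi> g u" if "continuous_on K g"
    using add assms(2,3) that by simp
  show "\<pi> (\<lambda>x. f x * g x) u = \<pi> f (\<pi> g u)" if "continuous_on K g"
    using mult assms(2,3) that by simp
  have "is_adjoint H H (\<pi> f) (\<pi> (\<lambda>x. cnj (f x)))"
    using adjoint assms(3) by blast
  then show "cinner H (\<pi> f u) v = cinner H u (\<pi> (\<lambda>x. cnj (f x)) v)" if "v \<in> carrier H"
    using assms(2) that unfolding is_adjoint_def by blast
qed

abbreviation (input) cplx :: "('a \<Rightarrow> real) \<Rightarrow> 'a \<Rightarrow> complex" where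
  "cplx a \<equiv> \<lambda>x. complex_of_real (a x)"

lemma star_representation_adjoint_real:
  assumes "star_representation K H \<pi>" "u \<in> carrier H" "v \<in> carrier H" "continuous_on K a"
  shows "cinner H (\<pi> (cplx a) u) v = cinner H u (\<pi> (cplx a) v)"
  using star_representation_adjoint[OF assms(1,2) _ assms(3), of "cplx a"] assms(4)
  by (simp add: continuous_intros)

text \<open>
  As \<open>a = \<surd>a * \<surd>a\<close>, the inner product is the squared norm of \<open>\<pi>(\<surd>a)u\<close>.
\<close>

lemma star_representation_nonneg:
  assumes H: "hilbert_space H" and \<pi>: "star_representation K H \<pi>" and u: "u \<in> carrier H"
    and a: "continuous_on K a" "\<And>x. x \<in> K \<Longrightarrow> 0 \<le> a x"
  shows "0 \<le> Re (cinner H (\<pi> (cplx a) u) u)"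
proof -
  let ?s = "\<lambda>x. sqrt (a x)"
  have cont: "continuous_on K (cplx ?s)" "continuous_on K ?s" "continuous_on K (cplx a)"
    using a(1) by (auto intro!: continuous_intros)
  note closed = star_representation_closed[OF \<pi> u cont(1)]
  have "\<pi> (cplx a) u = \<pi> (\<lambda>x. cplx ?s x * cplx ?s x) u"
    using cont a(2)
    by (intro star_representation_cong[OF \<pi> u]) (auto intro!: continuous_intros simp flip: of_real_mult)
  also have "\<dots> = \<pi> (cplx ?s) (\<pi> (cplx ?s) u)"
    by (rule star_representation_mult[OF \<pi> u cont(1) cont(1)])
  finally have "cinner H (\<pi> (cplx a) u) u = cinner H (\<pi> (cplx ?s) u) (\<pi> (cplx ?s) u)"
    using star_representation_adjoint_real[OF \<pi> closed u cont(2)] by simp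
  then show ?thesis
    using hilbert_space.cinner_nonneg[OF H closed] by simp
qed

lemma star_representation_square_expand:
  assumes H: "hilbert_space H" and \<pi>: "star_representation K H \<pi>"
    and u: "u \<in> carrier H" and v: "v \<in> carrier H"
    and a: "continuous_on K a" and b: "continuous_on K b"
  shows "Re (cinner H (\<pi> (cplx a) (u \<oplus>\<^bsub>H\<^esub> \<pi> (cplx b) v)) (u \<oplus>\<^bsub>H\<^esub> \<pi> (cplx b) v)) =
    Re (cinner H (\<pi> (cplx a) u) u) + 2 * Re (cinner H (\<pi> (cplx (\<lambda>x. a x * b x)) u) v)
      + Re (cinner H (\<pi> (cplx (\<lambda>x. a x * (b x)\<^sup>2)) v) v)"
proof -
  interpret hilbert_space H by (rule H)
  have ca: "continuous_on K (cplx a)" and cb: "continuous_on K (cplx b)"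
    and cab: "continuous_on K (cplx (\<lambda>x. a x * b x))"
    using a b by (auto intro!: continuous_intros)
  note closed = star_representation_closed[OF \<pi>]
  have bv: "\<pi> (cplx b) v \<in> carrier H" and au: "\<pi> (cplx a) u \<in> carrier H"
    using closed u v ca cb by auto
  have abv: "\<pi> (cplx a) (\<pi> (cplx b) v) \<in> carrier H"
    using closed bv ca by auto
  have mult: "\<pi> (cplx (\<lambda>x. a x * b x)) w = \<pi> (cplx a) (\<pi> (cplx b) w)"
    "\<pi> (cplx (\<lambda>x. a x * b x)) w = \<pi> (cplx b) (\<pi> (cplx a) w)" if "w \<in> carrier H" for w
    using star_representation_mult[OF \<pi> that ca cb] star_representation_mult[OF \<pi> that cb ca]
    by (simp_all add: mult.commute)
  have uv: "cinner H (\<pi> (cplx a) u) (\<pi> (cplx b) v) = cinner H (\<pi> (cplx (\<lambda>x. a x * b x)) u) v"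
    using star_representation_adjoint_real[OF \<pi> au v b] mult(2)[OF u] by simp
  have "cinner H (\<pi> (cplx a) (\<pi> (cplx b) v)) u = cinner H (\<pi> (cplx b) v) (\<pi> (cplx a) u)"
    by (rule star_representation_adjoint_real[OF \<pi> bv u a])
  also have "\<dots> = cnj (cinner H (\<pi> (cplx (\<lambda>x. a x * b x)) u) v)"
    using cinner_commute[OF bv au] uv by simp
  finally have vu: "Re (cinner H (\<pi> (cplx a) (\<pi> (cplx b) v)) u)
      = Re (cinner H (\<pi> (cplx (\<lambda>x. a x * b x)) u) v)"
    by simp
  have "cinner H (\<pi> (cplx a) (\<pi> (cplx b) v)) (\<pi> (cplx b) v)
      = cinner H (\<pi> (cplx b) (\<pi> (cplx a) (\<pi> (cplx b) v))) v"
    by (rule star_representation_adjoint_real[OF \<pi> abv v b, symmetric])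
  also have "\<pi> (cplx b) (\<pi> (cplx a) (\<pi> (cplx b) v)) = \<pi> (cplx b) (\<pi> (cplx (\<lambda>x. a x * b x)) v)"
    using mult(1)[OF v] by simp
  also have "\<dots> = \<pi> (cplx (\<lambda>x. a x * (b x)\<^sup>2)) v"
    using star_representation_mult[OF \<pi> v cb cab] by (simp add: power2_eq_square mult_ac)
  finally have vv: "cinner H (\<pi> (cplx a) (\<pi> (cplx b) v)) (\<pi> (cplx b) v)
      = cinner H (\<pi> (cplx (\<lambda>x. a x * (b x)\<^sup>2)) v) v" .
  show ?thesis
    using u bv au abv uv vu vv
    by (simp add: star_representation_add_vector[OF \<pi> u ca bv] cinner_add cinner_add_right)
qed

text \<open>
  A representation may be degenerate, so \<open>\<pi>(1)\<close> is only a projection. The part \<open>z = u - \<pi>(1)u\<close>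
  that it kills is invisible after the dilation as well: \<open>\<sigma>(1)\<close> is a projection too, so
  \<open>\<parallel>\<sigma>(1)Vz\<parallel>\<^sup>2 = \<langle>\<sigma>(1)Vz, Vz\<rangle> = \<langle>\<pi>(1)z, z\<rangle> = 0\<close>, and \<open>\<sigma>(c) = \<sigma>(c)\<sigma>(1)\<close>.
\<close>

lemma compression_unit_absorb:
  assumes H: "hilbert_space H" and L: "hilbert_space L"
    and \<pi>: "star_representation K H \<pi>" and \<sigma>: "star_representation K L \<sigma>"
    and V: "linear_operator H L V"
    and compress: "\<And>u. u \<in> carrier H \<Longrightarrow>
      cinner L (\<sigma> (\<lambda>_. 1) (V u)) (V u) = cinner H (\<pi> (\<lambda>_. 1) u) u"
    and u: "u \<in> carrier H" and w: "w \<in> carrier L" and c: "continuous_on K c"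
  shows "cinner L (\<sigma> c (V (\<pi> (\<lambda>_. 1) u))) w = cinner L (\<sigma> c (V u)) w"
proof -
  interpret H: hilbert_space H by (rule H)
  interpret L: hilbert_space L by (rule L)
  let ?one = "\<lambda>_. 1 :: complex"
  have one: "continuous_on K ?one"
    by simp
  have Vcl: "V v \<in> carrier L" if "v \<in> carrier H" for v
    using V that by (auto simp: linear_operator_def)
  have Pu: "\<pi> ?one u \<in> carrier H"
    by (rule star_representation_closed[OF \<pi> u one])
  then have mPu: "(-1) \<odot>\<^bsub>H\<^esub> \<pi> ?one u \<in> carrier H"
    by simp
  define z where "z = u \<oplus>\<^bsub>H\<^esub> (-1) \<odot>\<^bsub>H\<^esub> \<pi> ?one u"
  have z: "z \<in> carrier H"
    using u mPu by (simp add: z_def)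
  have PP: "\<pi> ?one (\<pi> ?one u) = \<pi> ?one u"
    using star_representation_mult[OF \<pi> u one one] by simp
  have "\<pi> ?one z = 1 \<odot>\<^bsub>H\<^esub> \<pi> ?one u \<oplus>\<^bsub>H\<^esub> (-1) \<odot>\<^bsub>H\<^esub> \<pi> ?one u"
    using Pu PP star_representation_add_vector[OF \<pi> u one mPu]
      star_representation_smult_vector[OF \<pi> Pu one, of "-1"] H.smult_one[OF Pu] by (simp add: z_def)
  also have "\<dots> = \<zero>\<^bsub>H\<^esub>"
    using H.smult_l_distr[of 1 "-1" "\<pi> ?one u"] H.smult_l_null[OF Pu] Pu by simp
  finally have "cinner L (\<sigma> ?one (V z)) (V z) = 0"
    using compress[OF z] H.cinner_zero_left[OF z] by simp
  moreover have "cinner L (\<sigma> ?one (V z)) (\<sigma> ?one (V z)) = cinner L (\<sigma> ?one (\<sigma> ?one (V z))) (V z)"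
    using star_representation_adjoint[OF \<sigma> star_representation_closed[OF \<sigma> Vcl[OF z] one] one Vcl[OF z]]
    by simp
  moreover have "\<sigma> ?one (\<sigma> ?one (V z)) = \<sigma> ?one (V z)"
    using star_representation_mult[OF \<sigma> Vcl[OF z] one one] by simp
  ultimately have zero: "\<sigma> ?one (V z) = \<zero>\<^bsub>L\<^esub>"
    using L.cinner_definite[OF star_representation_closed[OF \<sigma> Vcl[OF z] one]] by simp
  have "\<sigma> c (V z) = \<sigma> c (\<sigma> ?one (V z))"
    using star_representation_mult[OF \<sigma> Vcl[OF z] c one] by simp
  also have "\<dots> = \<sigma> c (0 \<odot>\<^bsub>L\<^esub> V z)"
    using zero Vcl[OF z] L.smult_l_null by simp
  also have "\<dots> = 0 \<odot>\<^bsub>L\<^esub> \<sigma> c (V z)"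
    by (rule star_representation_smult_vector[OF \<sigma> Vcl[OF z] c])
  finally have "cinner L (\<sigma> c (V z)) w = 0"
    using L.cinner_smult[OF star_representation_closed[OF \<sigma> Vcl[OF z] c] w, of 0] by simp
  moreover have "V z = V u \<oplus>\<^bsub>L\<^esub> (-1) \<odot>\<^bsub>L\<^esub> V (\<pi> ?one u)"
    using V u Pu mPu by (simp add: linear_operator_def z_def)
  ultimately show ?thesis
    using Vcl[OF u] Vcl[OF Pu] w c
    by (simp add: star_representation_add_vector[OF \<sigma>] star_representation_smult_vector[OF \<sigma>]
        star_representation_closed[OF \<sigma>] L.cinner_add L.cinner_smult)
qed

lemma cinner_compression:
  assumes H: "hilbert_space H" and L: "hilbert_space L"
    and \<sigma>: "star_representation K L \<sigma>"
    and V: "linear_operator H L V" and W: "is_adjoint H L V W"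
    and eq: "\<pi> a u = W (\<sigma> a (V u))"
    and a: "a \<in> affine_fun K" and u: "u \<in> carrier H"
  shows "cinner L (\<sigma> a (V u)) (V u) = cinner H (\<pi> a u) u"
proof -
  have Vu: "V u \<in> carrier L"
    using V u by (simp add: linear_operator_def)
  then have s: "\<sigma> a (V u) \<in> carrier L"
    using star_representation_closed[OF \<sigma>] a by (auto simp: affine_fun_def cont_fun_def)
  then have Ws: "W (\<sigma> a (V u)) \<in> carrier H"
    using W by (auto simp: is_adjoint_def bounded_operator_def linear_operator_def)
  have "cinner H (W (\<sigma> a (V u))) u = cnj (cinner H u (W (\<sigma> a (V u))))"
    by (rule hilbert_space.cinner_commute[OF H Ws u])
  also have "\<dots> = cnj (cinner L (V u) (\<sigma> a (V u)))"
    using W u s by (simp add: is_adjoint_def)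
  also have "\<dots> = cinner L (\<sigma> a (V u)) (V u)"
    by (rule hilbert_space.cinner_commute[OF L s Vu, symmetric])
  finally show ?thesis
    by (simp add: eq)
qed

section \<open>The upper bound for the dilation order\<close>

lemma coordinate_in_affine_fun: "cplx (\<lambda>x. x $ j) \<in> affine_fun K" for K :: "(real^3) set"
  by (auto simp: affine_fun_def cont_fun_def of_real_def scaleR_add_left intro!: continuous_intros)

text \<open>
  Write \<open>a\<^sub>j\<close> for the barycentric coordinates. Let \<open>u\<^sub>j = \<pi>(f\<^sub>j)\<xi>\<close> with \<open>f\<^sub>j = 3 - 4a\<^sub>j\<close>, and let
  \<open>q\<^sub>j = Vu\<^sub>j + \<sigma>(b\<^sub>j)\<eta>\<close> with \<open>b\<^sub>j = -15 (\<Prod>i\<noteq>j. a\<^sub>i)\<close>. Positivity of the coordinates gives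
  \<open>0 \<le> (\<Sum>j. \<langle>\<sigma>(a\<^sub>j)q\<^sub>j, q\<^sub>j\<rangle>)\<close>, and the right hand side can be computed from \<open>\<mu>\<close> and \<open>\<nu>\<^sub>t\<close> alone:

  \<^item> \<open>\<langle>\<sigma>(a\<^sub>j)Vu\<^sub>j, Vu\<^sub>j\<rangle> = \<langle>\<pi>(a\<^sub>j)u\<^sub>j, u\<^sub>j\<rangle>\<close> is the integral of \<open>a\<^sub>jf\<^sub>j\<^sup>2\<close> against \<open>\<mu>\<close>, because \<open>a\<^sub>j\<close>
    is affine; this contributes \<open>5/2\<close> in total.
  \<^item> The products \<open>a\<^sub>jb\<^sub>j\<close> are one and the same function \<open>c\<close>, and the \<open>f\<^sub>j\<close> sum to \<open>5\<close> on the
    triangle, so the mixed terms add up to \<open>2 \<cdot> 5\<close> times the integral of \<open>c\<close> against \<open>\<nu>\<^sub>t\<close>, which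
    is \<open>-50t/9\<close>.
  \<^item> The remaining terms are the integrals of \<open>a\<^sub>jb\<^sub>j\<^sup>2\<close> against \<open>\<nu>\<^sub>t\<close>, with sum \<open>25t/9\<close>.

  Hence \<open>0 \<le> 5/2 - 25t/9\<close>. The values \<open>1\<close> and \<open>2\<close> of \<open>f\<^sub>j\<close> at \<open>x\<^sub>j\<close> and at the other two points are
  the equality case of the Cauchy-Schwarz inequality
  \<open>(w\<^sub>1 + w\<^sub>2 + w\<^sub>3)\<^sup>2 \<le> (1/2 + 1 + 1)(2w\<^sub>1\<^sup>2 + w\<^sub>2\<^sup>2 + w\<^sub>3\<^sup>2)\<close>, whose quadratic form on the right has the
  weights \<open>a\<^sub>1(x\<^sub>i)\<close> up to scaling. The products in \<open>b\<^sub>j\<close> make \<open>a\<^sub>jb\<^sub>j\<close> independent of \<open>j\<close>, and the factor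
  \<open>15\<close> gives the smallest total.
\<close>

lemma dilation_imp_le_nine_tenths:
  fixes t :: real
  assumes t: "t \<in> {0..1}"
    and "representation std_triangle mu \<pi> H \<xi>" "representation std_triangle (nu t) \<sigma> L \<eta>"
    and "dilated_by std_triangle \<pi> H \<xi> \<sigma> L \<eta>"
  shows "t \<le> 9/10"
proof -
  let ?K = std_triangle
  have H: "hilbert_space H" and L: "hilbert_space L"
    and \<pi>: "star_representation ?K H \<pi>" and \<sigma>: "star_representation ?K L \<sigma>"
    and \<xi>: "\<xi> \<in> carrier H" and \<eta>: "\<eta> \<in> carrier L"
    and int_mu: "\<And>f. continuous_on ?K f \<Longrightarrow> cinner H (\<pi> f \<xi>) \<xi> = (\<integral>x. f x \<partial>mu)"
    and int_nu: "\<And>f. continuous_on ?K f \<Longrightarrow> cinner L (\<sigma> f \<eta>) \<eta> = (\<integral>x. f x \<partial>nu t)"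
    using assms(2,3) by (simp_all add: representation_def cont_fun_def)
  obtain V W where V: "linear_operator H L V" and W: "is_adjoint H L V W"
    and VW: "\<And>a u. a \<in> affine_fun ?K \<Longrightarrow> u \<in> carrier H \<Longrightarrow> \<pi> a u = W (\<sigma> a (V u))"
    and \<eta>_eq: "\<eta> = V \<xi>"
    using assms(4) by (auto simp: dilated_by_def isometry_operator_def)
  interpret H: hilbert_space H by (rule H)
  interpret L: hilbert_space L by (rule L)
  have compress: "cinner L (\<sigma> a (V u)) (V u) = cinner H (\<pi> a u) u"
    if "a \<in> affine_fun ?K" "u \<in> carrier H" for a u
    using VW[OF that] by (rule cinner_compression[OF H L \<sigma> V W _ that])
  have V_closed: "V u \<in> carrier L" if "u \<in> carrier H" for u
    using V that by (simp add: linear_operator_def)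
  define f :: "3 \<Rightarrow> real^3 \<Rightarrow> real" where "f j = (\<lambda>x. 3 - 4 * x $ j)" for j
  define b :: "3 \<Rightarrow> real^3 \<Rightarrow> real" where
    "b j = (\<lambda>x. - 15 * (\<Prod>i\<in>UNIV - {j}. x $ i))" for j
  define c :: "real^3 \<Rightarrow> real" where "c = (\<lambda>x. - 15 * (\<Prod>i\<in>UNIV. x $ i))"
  have cont_f: "continuous_on S (f j)" and cont_b: "continuous_on S (b j)"
    and cont_c: "continuous_on S c" for S j
    unfolding f_def b_def c_def by (intro continuous_intros)+
  have cont_cf: "continuous_on S (cplx (f j))" and cont_cc: "continuous_on S (cplx c)" for S j
    by (intro continuous_intros cont_f cont_c)+
  have c_eq: "x $ j * b j x = c x" for x j
    by (simp add: c_def b_def prod.remove[of UNIV j] mult_ac)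
  have c_vertex: "c (vertex i) = 0" for i
    unfolding c_def UNIV_3 using exhaust_3[of i] by (auto simp: vertex_nth)
  have c_barycenter: "c barycenter = - 5/9"
    unfolding c_def UNIV_3 by (simp add: barycenter_nth)
  define u where "u j = \<pi> (cplx (f j)) \<xi>" for j
  have u: "u j \<in> carrier H" for j
    unfolding u_def by (rule star_representation_closed[OF \<pi> \<xi> cont_cf])
  define q where "q j = V (u j) \<oplus>\<^bsub>L\<^esub> \<sigma> (cplx (b j)) \<eta>" for j
  have q: "q j \<in> carrier L" for j
    unfolding q_def using u V_closed \<eta> cont_b
    by (auto intro!: star_representation_closed[OF \<sigma>] continuous_intros)
  \<comment> \<open>The coordinates are affine and therefore pass through the compression.\<close>
  have A: "Re (cinner L (\<sigma> (cplx (\<lambda>x. x $ j)) (V (u j))) (V (u j))) = 5/6" for j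
  proof -
    have cj: "continuous_on ?K (cplx (\<lambda>x. x $ j))"
      by (intro continuous_intros)
    have "cinner L (\<sigma> (cplx (\<lambda>x. x $ j)) (V (u j))) (V (u j))
        = cinner H (\<pi> (cplx (\<lambda>x. x $ j)) (u j)) (u j)"
      by (rule compress[OF coordinate_in_affine_fun u])
    also have "\<dots> = cinner H (\<pi> (cplx (f j)) (\<pi> (cplx (\<lambda>x. x $ j)) (u j))) \<xi>"
      unfolding u_def
      by (rule star_representation_adjoint_real[OF \<pi> _ \<xi> cont_f, symmetric])
         (intro star_representation_closed[OF \<pi>] \<xi> cont_cf cj)
    also have "\<pi> (cplx (f j)) (\<pi> (cplx (\<lambda>x. x $ j)) (u j))
        = \<pi> (\<lambda>x. cplx (f j) x * (cplx (\<lambda>x. x $ j) x * cplx (f j) x)) \<xi>"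
      unfolding u_def
      by (subst star_representation_mult[OF \<pi> \<xi> cont_cf])
         (auto intro!: continuous_intros cont_f star_representation_mult[OF \<pi> \<xi> cj cont_cf, symmetric]
           arg_cong[where f = "\<pi> (cplx (f j))"])
    also have "cinner H \<dots> \<xi> = (\<integral>x. cplx (f j) x * (cplx (\<lambda>x. x $ j) x * cplx (f j) x) \<partial>mu)"
      by (intro int_mu continuous_intros cont_f)
    also have "\<dots> = of_real (5/6)"
      using exhaust_3[of j]
      by (subst integral_mu)
         (auto intro!: continuous_intros cont_f simp: f_def sum_3 inner_pt_nth scaleR_conv_of_real)
    finally have eq: "cinner L (\<sigma> (cplx (\<lambda>x. x $ j)) (V (u j))) (V (u j)) = of_real (5/6)" .
    show ?thesis
      unfolding eq by simp
  qed
  \<comment> \<open>The mixed terms depend on \<open>f j\<close> linearly, so that only the sum of the \<open>f j\<close> matters.\<close>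
  have B: "(\<Sum>j\<in>UNIV. Re (cinner L (\<sigma> (cplx (\<lambda>x. x $ j * b j x)) (V (u j))) \<eta>)) = - 25/9 * t"
  proof -
    define \<Phi> where "\<Phi> g = cinner L (\<sigma> (cplx c) (V (\<pi> g \<xi>))) \<eta>" for g
    have \<Phi>_add: "\<Phi> (\<lambda>x. g x + h x) = \<Phi> g + \<Phi> h"
      if "continuous_on ?K g" "continuous_on ?K h" for g h
    proof -
      have gh: "\<pi> g \<xi> \<in> carrier H" "\<pi> h \<xi> \<in> carrier H"
        using star_representation_closed[OF \<pi> \<xi>] that by auto
      then have "V (\<pi> g \<xi> \<oplus>\<^bsub>H\<^esub> \<pi> h \<xi>) = V (\<pi> g \<xi>) \<oplus>\<^bsub>L\<^esub> V (\<pi> h \<xi>)"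
        using V by (simp add: linear_operator_def)
      with gh \<eta> show ?thesis
        by (simp add: \<Phi>_def star_representation_add[OF \<pi> \<xi> that] L.cinner_add V_closed
            star_representation_add_vector[OF \<sigma> _ cont_cc] star_representation_closed[OF \<sigma> _ cont_cc])
    qed
    have \<Phi>_smult: "\<Phi> (\<lambda>x. s * g x) = s * \<Phi> g" if "continuous_on ?K g" for s g
    proof -
      have g: "\<pi> g \<xi> \<in> carrier H"
        using star_representation_closed[OF \<pi> \<xi>] that by auto
      then have "V (s \<odot>\<^bsub>H\<^esub> \<pi> g \<xi>) = s \<odot>\<^bsub>L\<^esub> V (\<pi> g \<xi>)"
        using V by (simp add: linear_operator_def)
      with g \<eta> show ?thesis
        by (simp add: \<Phi>_def star_representation_smult[OF \<pi> \<xi> that] L.cinner_smult V_closed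
            star_representation_smult_vector[OF \<sigma> _ cont_cc] star_representation_closed[OF \<sigma> _ cont_cc])
    qed
    have \<Phi>_one: "\<Phi> (\<lambda>_. 1) = (\<integral>x. cplx c x \<partial>nu t)"
    proof -
      have "(\<lambda>_. 1) \<in> affine_fun ?K"
        by (auto simp: affine_fun_def cont_fun_def scaleR_conv_of_real simp flip: of_real_add)
      then have "\<Phi> (\<lambda>_. 1) = cinner L (\<sigma> (cplx c) (V \<xi>)) \<eta>"
        unfolding \<Phi>_def
        by (intro compression_unit_absorb[OF H L \<pi> \<sigma> V] compress \<xi> \<eta> cont_cc)
      then show ?thesis
        using int_nu[OF cont_cc] \<eta>_eq by simp
    qed
    have "(\<Sum>j\<in>UNIV. \<Phi> (cplx (f j))) = \<Phi> (\<lambda>x. cplx (f 1) x + cplx (f 2) x + cplx (f 3) x)"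
      by (subst \<Phi>_add, intro continuous_on_add cont_cf, rule cont_cf, subst \<Phi>_add)
         (simp_all add: cont_f sum_3)
    also have "\<dots> = \<Phi> (\<lambda>x. 5 * 1)"
    proof -
      have "complex_of_real (f 1 x) + complex_of_real (f 2 x) + complex_of_real (f 3 x) = 5 * 1"
        if "x \<in> ?K" for x
      proof -
        have "f 1 x + f 2 x + f 3 x = 5"
          using std_triangle_coordinates(2)[OF that] by (simp add: f_def)
        then show ?thesis
          by (simp flip: of_real_add)
      qed
      then show ?thesis
        unfolding \<Phi>_def by (subst star_representation_cong[OF \<pi> \<xi>]) (auto intro!: continuous_intros cont_f)
    qed
    also have "\<dots> = 5 * (\<integral>x. cplx c x \<partial>nu t)"
      using \<Phi>_smult[of "\<lambda>_. 1" 5] by (simp add: \<Phi>_one)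
    also have "\<dots> = of_real (- 25/9 * t)"
      by (subst integral_nu[OF t cont_cc]) (simp add: c_vertex c_barycenter scaleR_conv_of_real)
    finally have "Re (\<Sum>j\<in>UNIV. \<Phi> (cplx (f j))) = - 25/9 * t"
      by simp
    then show ?thesis
      by (simp add: c_eq \<Phi>_def u_def)
  qed
  have C: "(\<Sum>j\<in>UNIV. Re (cinner L (\<sigma> (cplx (\<lambda>x. x $ j * (b j x)\<^sup>2)) \<eta>) \<eta>)) = 25/9 * t"
  proof -
    have summand: "Re (cinner L (\<sigma> (cplx (\<lambda>x. x $ j * (b j x)\<^sup>2)) \<eta>) \<eta>) = 25/27 * t" for j
    proof -
      define g where "g = (\<lambda>x. x $ j * (b j x)\<^sup>2)"
      have g_vertex: "g (vertex i) = 0" for i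
        using c_eq[of "vertex i" j] c_vertex[of i] by (auto simp: g_def power2_eq_square)
      have g_barycenter: "g barycenter = 25/27"
        by (simp add: g_def b_def barycenter_nth power2_eq_square)
      have cont: "continuous_on ?K (cplx g)"
        unfolding g_def by (intro continuous_intros cont_b)
      have "cinner L (\<sigma> (cplx g) \<eta>) \<eta> = of_real (25/27 * t)"
        unfolding int_nu[OF cont] integral_nu[OF t cont]
        by (simp add: g_vertex g_barycenter scaleR_conv_of_real)
      then show ?thesis
        by (simp only: g_def Re_complex_of_real)
    qed
    show ?thesis
      unfolding summand by simp
  qed
  have "0 \<le> (\<Sum>j\<in>UNIV. Re (cinner L (\<sigma> (cplx (\<lambda>x. x $ j)) (q j)) (q j)))"
    by (intro sum_nonneg star_representation_nonneg[OF L \<sigma> q])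
       (auto simp: std_triangle_coordinates intro!: continuous_intros)
  also have "\<dots> = (\<Sum>j\<in>UNIV. 5/6 + 2 * Re (cinner L (\<sigma> (cplx (\<lambda>x. x $ j * b j x)) (V (u j))) \<eta>)
      + Re (cinner L (\<sigma> (cplx (\<lambda>x. x $ j * (b j x)\<^sup>2)) \<eta>) \<eta>))"
    unfolding q_def
    by (subst star_representation_square_expand[OF L \<sigma> V_closed[OF u] \<eta> _ cont_b])
       (auto simp: A intro!: continuous_intros)
  also have "\<dots> = 5/2 - 25/9 * t"
    using B C by (simp add: sum.distrib flip: sum_distrib_left)
  finally show ?thesis
    by simp
qed

section \<open>Coordinate Hilbert spaces\<close>

text \<open>
  The left inverse of an injective coding map; plain \<open>inv\<close> would be read as the inverse in a group.
\<close>

abbreviation decode :: "('a \<Rightarrow> 'b) \<Rightarrow> 'b \<Rightarrow> 'a" where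
  "decode \<equiv> inv_into UNIV"

text \<open>
  The Hilbert space \<open>\<complex>\<^sup>n\<close>, carried over to an arbitrary type along an injection \<open>J\<close>. All operations
  decode their arguments first, also outside the range of \<open>J\<close>; this way the distance function is
  symmetric and nonnegative on the whole type, as the abstract notion of a metric space requires.
\<close>

definition coordinate_hilbert :: "(complex^'k \<Rightarrow> 'h) \<Rightarrow> 'h prehilbert" where
  "coordinate_hilbert J =
    \<lparr>carrier = range J, mult = (\<lambda>u v. u), one = J 0, zero = J 0,
     add = (\<lambda>u v. J (decode J u + decode J v)), smult = (\<lambda>c u. J (c *s decode J u)),
     cinner = (\<lambda>u v. \<Sum>k\<in>UNIV. decode J u $ k * cnj (decode J v $ k))\<rparr>"

lemma coordinate_hilbert_simps [simp]:
  "carrier (coordinate_hilbert J) = range J"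
  "zero (coordinate_hilbert J) = J 0"
  "add (coordinate_hilbert J) u v = J (decode J u + decode J v)"
  "smult (coordinate_hilbert J) c u = J (c *s decode J u)"
  "cinner (coordinate_hilbert J) u v = (\<Sum>k\<in>UNIV. decode J u $ k * cnj (decode J v $ k))"
  by (simp_all add: coordinate_hilbert_def)

lemma sum_mult_cnj_eq_norm_power2:
  fixes z :: "complex^'k"
  shows "(\<Sum>k\<in>UNIV. z $ k * cnj (z $ k)) = of_real ((norm z)\<^sup>2)"
  by (simp add: norm_vec_def L2_set_def sum_nonneg flip: complex_norm_square)

lemma hnorm_coordinate_hilbert [simp]: "hnorm (coordinate_hilbert J) u = norm (decode J u)"
  unfolding hnorm_def coordinate_hilbert_simps sum_mult_cnj_eq_norm_power2 by simp

text \<open>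
  Addition decodes its arguments, so even a vector outside the carrier has exactly one negative in
  the carrier, and the formula holds for all \<open>u\<close> and \<open>v\<close>.
\<close>

lemma minus_coordinate_hilbert:
  assumes "inj J"
  shows "u \<ominus>\<^bsub>coordinate_hilbert J\<^esub> v = J (decode J u - decode J v)"
proof -
  let ?H = "coordinate_hilbert J"
  have "(THE y. y \<in> range J \<and> J (decode J v + decode J y) = J 0 \<and> J (decode J y + decode J v) = J 0)
      = J (- decode J v)"
  proof (rule the_equality)
    fix y assume "y \<in> range J \<and> J (decode J v + decode J y) = J 0 \<and> J (decode J y + decode J v) = J 0"
    then obtain z where z: "y = J z" "decode J v + z = 0"
      using assms by (auto simp: inj_eq)
    then have "z = - decode J v"
      by (simp add: eq_neg_iff_add_eq_0 add.commute)
    with z show "y = J (- decode J v)"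
      by simp
  qed (use assms in simp)
  then have "\<ominus>\<^bsub>?H\<^esub> v = J (- decode J v)"
    by (simp add: a_inv_def m_inv_def)
  then show ?thesis
    using assms by (simp add: a_minus_def)
qed

lemma cring_complex_field: "cring complex_field"
proof (rule cringI)
  show "abelian_group complex_field"
    by (rule abelian_groupI) (auto simp: algebra_simps intro: exI[of _ "- x" for x])
  show "Group.comm_monoid complex_field"
    by (rule comm_monoidI) (auto simp: algebra_simps)
qed (auto simp: algebra_simps)

lemma hilbert_space_coordinate_hilbert:
  fixes J :: "complex^'k \<Rightarrow> 'h"
  assumes J: "inj J"
  shows "hilbert_space (coordinate_hilbert J)"
proof (intro hilbert_space.intro moduleI hilbert_space_axioms.intro)
  let ?H = "coordinate_hilbert J"
  show "cring complex_field"
    by (rule cring_complex_field)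
  show "abelian_group ?H"
  proof (rule abelian_groupI)
    fix u assume "u \<in> carrier ?H"
    then show "\<exists>v\<in>carrier ?H. v \<oplus>\<^bsub>?H\<^esub> u = \<zero>\<^bsub>?H\<^esub>"
      using J by (intro bexI[of _ "J (- decode J u)"]) auto
  qed (use J in \<open>auto simp: algebra_simps\<close>)
  show "Metric_space.mcomplete (carrier ?H) (\<lambda>u v. hnorm ?H (u \<ominus>\<^bsub>?H\<^esub> v))"
  proof -
    define d where "d = (\<lambda>u v. norm (decode J u - decode J v))"
    have d: "(\<lambda>u v. hnorm ?H (u \<ominus>\<^bsub>?H\<^esub> v)) = d"
      using J by (simp add: minus_coordinate_hilbert d_def)
    interpret Metric_space "range J" d
    proof
      fix u v w assume "u \<in> range J" "v \<in> range J" "w \<in> range J"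
      then show "d u v = 0 \<longleftrightarrow> u = v" "d u w \<le> d u v + d v w"
        using J norm_triangle_ineq[of "decode J u - decode J v" "decode J v - decode J w"]
        by (auto simp: d_def)
    qed (auto simp: d_def norm_minus_commute)
    have "mcomplete"
      unfolding mcomplete_def
    proof (intro allI impI)
      fix s assume s: "MCauchy s"
      then have "\<forall>e>0. \<exists>N. \<forall>n n'. N \<le> n \<longrightarrow> N \<le> n' \<longrightarrow> d (s n) (s n') < e"
        unfolding MCauchy_def by blast
      then have "Cauchy (\<lambda>n. decode J (s n))"
        unfolding Cauchy_def dist_norm d_def by blast
      then obtain l where "(\<lambda>n. decode J (s n)) \<longlonglongrightarrow> l"
        using Cauchy_convergent_iff convergent_def by blast
      then have "\<forall>e>0. \<exists>N. \<forall>n\<ge>N. d (s n) (J l) < e"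
        using J by (simp add: LIMSEQ_def dist_norm d_def)
      moreover have "s n \<in> range J" for n
        using s unfolding MCauchy_def by blast
      ultimately have "limitin mtopology s (J l) sequentially"
        unfolding limit_metric_sequentially by simp
      then show "\<exists>x. limitin mtopology s x sequentially" ..
    qed
    then show ?thesis
      unfolding d coordinate_hilbert_simps(1) .
  qed
  fix u v w :: 'h and c c' :: complex
  assume "u \<in> carrier ?H"
  then obtain x where x: "u = J x"
    by auto
  show "c \<odot>\<^bsub>?H\<^esub> u \<in> carrier ?H"
    by simp
  show "(c \<oplus>\<^bsub>complex_field\<^esub> c') \<odot>\<^bsub>?H\<^esub> u = c \<odot>\<^bsub>?H\<^esub> u \<oplus>\<^bsub>?H\<^esub> c' \<odot>\<^bsub>?H\<^esub> u"
    "(c \<otimes>\<^bsub>complex_field\<^esub> c') \<odot>\<^bsub>?H\<^esub> u = c \<odot>\<^bsub>?H\<^esub> (c' \<odot>\<^bsub>?H\<^esub> u)"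
    "\<one>\<^bsub>complex_field\<^esub> \<odot>\<^bsub>?H\<^esub> u = u"
    using J by (simp_all add: x vector_sadd_rdistrib vector_smult_assoc)
  show "0 \<le> Re (cinner ?H u u)"
    unfolding coordinate_hilbert_simps sum_mult_cnj_eq_norm_power2 by simp
  show "u = \<zero>\<^bsub>?H\<^esub>" if "cinner ?H u u = 0"
    using that J unfolding coordinate_hilbert_simps sum_mult_cnj_eq_norm_power2 by (simp add: x)
  show "cinner ?H u w = cnj (cinner ?H w u)"
    by (simp add: mult.commute)
  show "cinner ?H (c \<odot>\<^bsub>?H\<^esub> u) w = c * cinner ?H u w"
    using J by (simp add: sum_distrib_left mult_ac)
  show "c \<odot>\<^bsub>?H\<^esub> (u \<oplus>\<^bsub>?H\<^esub> v) = c \<odot>\<^bsub>?H\<^esub> u \<oplus>\<^bsub>?H\<^esub> c \<odot>\<^bsub>?H\<^esub> v"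
    using J by (simp add: vector_add_ldistrib)
  show "cinner ?H (u \<oplus>\<^bsub>?H\<^esub> v) w = cinner ?H u w + cinner ?H v w"
    using J by (simp add: sum.distrib distrib_right)
qed

lemma bounded_operator_coordinate:
  fixes J :: "complex^'k \<Rightarrow> 'h" and J' :: "complex^'l \<Rightarrow> 'h'"
  assumes J: "inj J" "inj J'"
  shows "bounded_operator (coordinate_hilbert J) (coordinate_hilbert J') (\<lambda>u. J' (A *v decode J u))"
proof -
  have "linear ((*v) A)"
  proof (rule linearI)
    show "A *v (x + y) = A *v x + A *v y" for x y
      by (rule matrix_vector_right_distrib)
    show "A *v (r *\<^sub>R x) = r *\<^sub>R (A *v x)" for r x
      by (simp add: vec_eq_iff matrix_vector_mult_def scaleR_sum_right)
  qed
  then obtain C where "\<And>x. norm (A *v x) \<le> C * norm x"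
    by (meson linear_bounded)
  with J show ?thesis
    unfolding bounded_operator_def linear_operator_def
    by (auto simp: matrix_vector_right_distrib vector_scalar_commute intro!: exI[of _ C])
qed

text \<open>
  Real numbers correspond to sets of naturals, so a complex vector is coded by finitely many such
  sets, hence by one subset of a countable set, hence by one real number, which gives a constant
  function.
\<close>

lemma ex_inj_into_complex_functions: "\<exists>J :: complex^'k \<Rightarrow> 'i \<Rightarrow> complex. inj J"
proof -
  obtain g :: "real \<Rightarrow> nat set" where g: "bij g"
    using nat_sets_eqpoll_reals eqpoll_sym unfolding eqpoll_def by blast
  define code :: "complex^'k \<Rightarrow> ('k \<times> bool \<times> nat) set" where
    "code z = {(k, b, n). n \<in> g (if b then Re (z $ k) else Im (z $ k))}" for z
  define J :: "complex^'k \<Rightarrow> 'i \<Rightarrow> complex" where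
    "J z = (\<lambda>_. of_real (decode g (to_nat ` code z)))" for z
  have "inj code"
  proof (rule injI)
    fix y z assume "code y = code z"
    then have *: "(k, b, n) \<in> code y \<longleftrightarrow> (k, b, n) \<in> code z" for k b n
      by simp
    have "g (Re (y $ k)) = g (Re (z $ k))" "g (Im (y $ k)) = g (Im (z $ k))" for k
      using *[of k True] *[of k False] by (auto simp: code_def)
    then show "y = z"
      using g by (simp add: bij_def inj_eq vec_eq_iff complex_eq_iff)
  qed
  moreover have "inj (\<lambda>A :: ('k \<times> bool \<times> nat) set. decode g (to_nat ` A))"
    using g by (auto intro!: injI simp: inj_image_eq_iff bij_imp_bij_inv bij_is_inj[THEN inj_eq])
  ultimately have "inj J"
    unfolding J_def inj_def fun_eq_iff by auto
  then show ?thesis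
    by blast
qed

section \<open>Evaluation representations and their dilations\<close>

definition diagonal :: "('k \<Rightarrow> complex) \<Rightarrow> complex^'k^'k" where
  "diagonal d = (\<chi> i j. if i = j then d i else 0)"

lemma diagonal_mult_nth [simp]: "(diagonal d *v z) $ k = d k * z $ k"
  by (simp add: diagonal_def matrix_vector_mult_def if_distrib[of "\<lambda>x. x * _"] cong: if_cong)

definition adjoint_matrix :: "complex^'k^'l \<Rightarrow> complex^'l^'k" where
  "adjoint_matrix R = (\<chi> k l. cnj (R $ l $ k))"

lemma is_adjoint_coordinate:
  fixes J :: "complex^'k \<Rightarrow> 'h" and J' :: "complex^'l \<Rightarrow> 'h'"
  assumes J: "inj J" "inj J'"
  shows "is_adjoint (coordinate_hilbert J) (coordinate_hilbert J')
    (\<lambda>u. J' (R *v decode J u)) (\<lambda>v. J (adjoint_matrix R *v decode J' v))"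
proof -
  have "(\<Sum>l\<in>UNIV. (R *v x) $ l * cnj (y $ l)) = (\<Sum>k\<in>UNIV. x $ k * cnj ((adjoint_matrix R *v y) $ k))"
    for x y
    unfolding matrix_vector_mult_def adjoint_matrix_def
    by (simp add: sum_distrib_left sum_distrib_right mult_ac) (rule sum.swap)
  then show ?thesis
    using J bounded_operator_coordinate[OF J(2,1)] by (simp add: is_adjoint_def)
qed

lemma adjoint_diagonal: "adjoint_matrix (diagonal d) = diagonal (\<lambda>k. cnj (d k))"
  by (auto simp: adjoint_matrix_def diagonal_def vec_eq_iff)

text \<open>
  The representation of \<open>C(K)\<close> by the diagonal matrices of the values at the points \<open>p k\<close>.
\<close>

definition evaluation_rep ::
    "(complex^'k \<Rightarrow> 'h) \<Rightarrow> ('k \<Rightarrow> 'a) \<Rightarrow> ('a \<Rightarrow> complex) \<Rightarrow> 'h \<Rightarrow> 'h" where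
  "evaluation_rep J p f u = J (diagonal (\<lambda>k. f (p k)) *v decode J u)"

lemma star_representation_evaluation_rep:
  fixes J :: "complex^'k \<Rightarrow> 'h"
  assumes J: "inj J" and p: "range p \<subseteq> K"
  shows "star_representation K (coordinate_hilbert J) (evaluation_rep J p)"
proof -
  let ?D = "\<lambda>f. diagonal (\<lambda>k. f (p k)) :: complex^'k^'k"
  have "?D f = ?D g" if "\<forall>x\<in>K. f x = g x" for f g
    using that p by (auto simp: diagonal_def vec_eq_iff)
  then have cong: "\<forall>f\<in>cont_fun K. \<forall>g\<in>cont_fun K. (\<forall>x\<in>K. f x = g x) \<longrightarrow>
      (\<forall>u\<in>carrier (coordinate_hilbert J). J (?D f *v decode J u) = J (?D g *v decode J u))"
    by metis
  have "?D (\<lambda>x. f x + g x) *v z = ?D f *v z + ?D g *v z"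
    "?D (\<lambda>x. f x * g x) *v z = ?D f *v (?D g *v z)" "?D (\<lambda>x. c * f x) *v z = c *s (?D f *v z)"
    for f g c z
    by (simp_all add: vec_eq_iff distrib_right)
  then show ?thesis
    unfolding star_representation_def evaluation_rep_def
    using J bounded_operator_coordinate[OF J J] is_adjoint_coordinate[OF J J, of "?D _"]
    by (intro conjI cong) (auto simp: adjoint_diagonal)
qed

text \<open>
  A matrix \<open>R\<close> compresses evaluation at the points \<open>q\<close> to evaluation at the points \<open>p\<close>, on affine
  functions, as soon as the associated sesquilinear forms agree. The constant function \<open>1\<close> is
  affine, so this already makes \<open>R\<close> isometric.
\<close>

lemma dilation_le_matrix:
  fixes J :: "complex^'k \<Rightarrow> 'h" and J' :: "complex^'l \<Rightarrow> 'h"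
    and K :: "'a::real_normed_vector set" and R :: "complex^'k^'l"
  assumes J: "inj J" "inj J'"
    and M: "M \<in> pos_measures K" "N \<in> pos_measures K"
    and p: "range p \<subseteq> K" and q: "range q \<subseteq> K"
    and int_M: "\<And>f. continuous_on K f \<Longrightarrow>
      (\<integral>x. f x \<partial>M) = (\<Sum>k\<in>UNIV. f (p k) * (z $ k * cnj (z $ k)))"
    and int_N: "\<And>f. continuous_on K f \<Longrightarrow>
      (\<integral>x. f x \<partial>N) = (\<Sum>l\<in>UNIV. f (q l) * ((R *v z) $ l * cnj ((R *v z) $ l)))"
    and compress: "\<And>a u v. a \<in> affine_fun K \<Longrightarrow>
      (\<Sum>l\<in>UNIV. a (q l) * ((R *v u) $ l * cnj ((R *v v) $ l)))
        = (\<Sum>k\<in>UNIV. a (p k) * (u $ k * cnj (v $ k)))"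
  shows "dilation_le TYPE('h) K M N"
proof -
  let ?H = "coordinate_hilbert J" and ?L = "coordinate_hilbert J'"
  let ?\<pi> = "evaluation_rep J p" and ?\<sigma> = "evaluation_rep J' q"
  let ?V = "\<lambda>u. J' (R *v decode J u)" and ?W = "\<lambda>v. J (adjoint_matrix R *v decode J' v)"
  have rep_M: "representation K M ?\<pi> ?H (J z)"
    using J p int_M unfolding representation_def
    by (auto simp: hilbert_space_coordinate_hilbert star_representation_evaluation_rep
        evaluation_rep_def cont_fun_def mult.assoc)
  have rep_N: "representation K N ?\<sigma> ?L (J' (R *v z))"
    using J q int_N unfolding representation_def
    by (auto simp: hilbert_space_coordinate_hilbert star_representation_evaluation_rep
        evaluation_rep_def cont_fun_def mult.assoc)
  have one: "(\<lambda>_. 1) \<in> affine_fun K"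
    by (auto simp: affine_fun_def cont_fun_def scaleR_conv_of_real simp flip: of_real_add)
  have "complex_of_real ((norm (R *v x))\<^sup>2) = of_real ((norm x)\<^sup>2)" for x
    unfolding sum_mult_cnj_eq_norm_power2[symmetric] using compress[OF one, of x x] by simp
  then have "(norm (R *v x))\<^sup>2 = (norm x)\<^sup>2" for x
    by (simp only: of_real_eq_iff)
  then have norm_R: "norm (R *v x) = norm x" for x
    by simp
  have iso: "isometry_operator ?H ?L ?V"
    using bounded_operator_coordinate[OF J, of R] J
    by (simp add: isometry_operator_def bounded_operator_def norm_R)
  have "adjoint_matrix R *v (diagonal (\<lambda>l. a (q l)) *v (R *v x)) = diagonal (\<lambda>k. a (p k)) *v x"
    if a: "a \<in> affine_fun K" for a x
  proof (subst vec_eq_iff, rule allI)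
    fix k
    have R: "(R *v axis k 1) $ l = R $ l $ k" for l
      by (simp add: matrix_vector_mult_def axis_def if_distrib cong: if_cong)
    have "(adjoint_matrix R *v (diagonal (\<lambda>l. a (q l)) *v (R *v x))) $ k
        = (\<Sum>l\<in>UNIV. a (q l) * ((R *v x) $ l * cnj ((R *v axis k 1) $ l)))"
      unfolding R matrix_vector_mult_def[of "adjoint_matrix R"]
      by (simp add: adjoint_matrix_def mult_ac)
    also have "\<dots> = (\<Sum>i\<in>UNIV. a (p i) * (x $ i * cnj (axis k 1 $ i)))"
      by (rule compress[OF a])
    also have "\<dots> = (diagonal (\<lambda>k. a (p k)) *v x) $ k"
      by (simp add: axis_def if_distrib cong: if_cong)
    finally show "(adjoint_matrix R *v (diagonal (\<lambda>l. a (q l)) *v (R *v x))) $ k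
      = (diagonal (\<lambda>k. a (p k)) *v x) $ k" .
  qed
  then have "\<forall>a\<in>affine_fun K. \<forall>u\<in>carrier ?H. ?\<pi> a u = ?W (?\<sigma> a (?V u))"
    using J by (auto simp: evaluation_rep_def)
  moreover have "J' (R *v z) = ?V (J z)"
    using J by simp
  ultimately have "dilated_by K ?\<pi> ?H (J z) ?\<sigma> ?L (J' (R *v z))"
    unfolding dilated_by_def using iso is_adjoint_coordinate[OF J, of R] by blast
  with M rep_M rep_N show ?thesis
    unfolding dilation_le_def by blast
qed

section \<open>The optimal dilation\<close>

lemma sum_pair: "(\<Sum>l\<in>(UNIV :: ('a::finite \<times> 'b::finite) set). f l) = (\<Sum>p\<in>UNIV. \<Sum>i\<in>UNIV. f (p, i))"
  by (simp add: sum.cartesian_product flip: UNIV_Times_UNIV)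

text \<open>
  With \<open>D\<close> the diagonal matrix of the \<open>d i\<close> and \<open>b\<close> the vector with entries \<open>1 / d i\<close>, the left hand
  side is the form of \<open>B\<^sup>TB\<close> for \<open>B = (1 - \<kappa>bb\<^sup>T)D\<close>. Since \<open>Db\<close> is the all-ones vector, \<open>B\<^sup>TB\<close> is
  \<open>D\<^sup>2\<close> plus a multiple of the all-ones matrix. Choosing \<open>\<kappa>\<close> factorises such
  rank-one perturbations explicitly.
\<close>

lemma rank_one_square_root:
  fixes u v :: "complex^'n" and d :: "'n \<Rightarrow> real" and \<kappa> :: real
  assumes d: "\<And>i. d i \<noteq> 0"
  defines "S \<equiv> \<lambda>u::complex^'n. \<Sum>i\<in>UNIV. u $ i"
  shows "(\<Sum>i\<in>UNIV. (of_real (d i) * u $ i - of_real (\<kappa> / d i) * S u)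
        * cnj (of_real (d i) * v $ i - of_real (\<kappa> / d i) * S v))
    = (\<Sum>i\<in>UNIV. of_real ((d i)\<^sup>2) * (u $ i * cnj (v $ i)))
      + of_real (\<kappa>\<^sup>2 * (\<Sum>i\<in>UNIV. 1 / (d i)\<^sup>2) - 2 * \<kappa>) * (S u * cnj (S v))"
proof -
  have "(of_real (d i) * u $ i - of_real (\<kappa> / d i) * S u)
        * cnj (of_real (d i) * v $ i - of_real (\<kappa> / d i) * S v)
      = of_real ((d i)\<^sup>2) * (u $ i * cnj (v $ i)) - of_real \<kappa> * (u $ i * cnj (S v))
        - of_real \<kappa> * (S u * cnj (v $ i)) + of_real (\<kappa>\<^sup>2 * (1 / (d i)\<^sup>2)) * (S u * cnj (S v))" for i
    using d[of i] by (simp add: field_simps power2_eq_square)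
  moreover have "(\<Sum>i\<in>UNIV. of_real \<kappa> * (u $ i * cnj (S v))) = of_real \<kappa> * (S u * cnj (S v))"
    by (simp only: S_def sum_distrib_left[symmetric] sum_distrib_right[symmetric])
  moreover have "(\<Sum>i\<in>UNIV. of_real \<kappa> * (S u * cnj (v $ i))) = of_real \<kappa> * (S u * cnj (S v))"
    by (simp only: S_def sum_distrib_left[symmetric] cnj_sum)
  moreover have "(\<Sum>i\<in>UNIV. of_real (\<kappa>\<^sup>2 * (1 / (d i)\<^sup>2)) * (S u * cnj (S v)))
      = of_real (\<kappa>\<^sup>2 * (\<Sum>i\<in>UNIV. 1 / (d i)\<^sup>2)) * (S u * cnj (S v))"
    by (simp only: sum_distrib_left sum_distrib_right[symmetric] of_real_sum)
  ultimately show ?thesis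
    by (simp only: sum.distrib sum_subtractf) (simp add: algebra_simps)
qed

text \<open>
  The squares of these numbers are the coordinates of \<open>x\<^sub>i\<close>: \<open>a\<^sub>j(x\<^sub>i)\<close> is \<open>1/2\<close> for \<open>i = j\<close> and \<open>1/4\<close>
  otherwise.
\<close>

definition dilation_scale :: "3 \<Rightarrow> 3 \<Rightarrow> real" where
  "dilation_scale j i = sqrt (if i = j then 1/2 else 1/4)"

text \<open>
  The smaller root of \<open>10\<kappa>\<^sup>2 - 2\<kappa> = -t/9\<close>; the roots are real exactly for \<open>t \<le> 9/10\<close>.
\<close>

definition dilation_shift :: "real \<Rightarrow> real" where
  "dilation_shift t = (1 - sqrt (1 - 10/9 * t)) / 10"

text \<open>
  The three rows indexed by an atom of \<open>\<nu>\<^sub>t\<close> form a square root, in the sense \<open>Q = B\<^sup>*B\<close>, of the positive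
  matrix \<open>Q\<close> attached to that atom. This is \<open>(t/3)\<close> times the all-ones matrix \<open>E\<close> for the
  barycentre, and the diagonal matrix of the \<open>a\<^sub>j(x\<^sub>i)\<close> minus \<open>(t/9)E\<close> for the \<open>j\<close>-th vertex.
\<close>

definition dilation_matrix :: "real \<Rightarrow> complex^3^(3 option \<times> 3)" where
  "dilation_matrix t = (\<chi> l k. of_real (case l of
      (None, i) \<Rightarrow> sqrt t / 3
    | (Some j, i) \<Rightarrow> (if i = k then dilation_scale j i else 0) - dilation_shift t / dilation_scale j i))"

lemma dilation_matrix_nth:
  "(dilation_matrix t *v z) $ (None, i) = of_real (sqrt t / 3) * (\<Sum>k\<in>UNIV. z $ k)"
  "(dilation_matrix t *v z) $ (Some j, i) = of_real (dilation_scale j i) * z $ i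
    - of_real (dilation_shift t / dilation_scale j i) * (\<Sum>k\<in>UNIV. z $ k)"
proof -
  show "(dilation_matrix t *v z) $ (None, i) = of_real (sqrt t / 3) * (\<Sum>k\<in>UNIV. z $ k)"
    by (simp add: dilation_matrix_def matrix_vector_mult_def sum_distrib_left)
  have "(dilation_matrix t *v z) $ (Some j, i) =
      (\<Sum>k\<in>UNIV. (if k = i then of_real (dilation_scale j i) * z $ k else 0)
        - of_real (dilation_shift t / dilation_scale j i) * z $ k)"
    unfolding dilation_matrix_def matrix_vector_mult_def
    by (auto intro!: sum.cong simp: algebra_simps)
  then show "(dilation_matrix t *v z) $ (Some j, i) = of_real (dilation_scale j i) * z $ i
    - of_real (dilation_shift t / dilation_scale j i) * (\<Sum>k\<in>UNIV. z $ k)"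
    by (simp add: sum_subtractf sum_distrib_left)
qed

lemma dilation_matrix_gram_barycenter:
  assumes "0 \<le> t"
  shows "(\<Sum>i\<in>UNIV. (dilation_matrix t *v u) $ (None, i) * cnj ((dilation_matrix t *v v) $ (None, i)))
    = of_real (t/3) * ((\<Sum>k\<in>UNIV. u $ k) * cnj (\<Sum>k\<in>UNIV. v $ k))"
proof -
  have "of_real (sqrt t / 3) * of_real (sqrt t / 3) = complex_of_real (t / 9)"
    using assms by (simp flip: of_real_mult)
  then have "of_real (sqrt t / 3) * a * cnj (of_real (sqrt t / 3) * b) = of_real (t/9) * (a * cnj b)"
    for a b :: complex
    by (metis complex_cnj_complex_of_real complex_cnj_mult mult.assoc mult.left_commute)
  then show ?thesis
    by (simp add: dilation_matrix_nth)
qed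

lemma dilation_matrix_gram_vertex:
  assumes "t \<le> 9/10"
  shows "(\<Sum>i\<in>UNIV. (dilation_matrix t *v u) $ (Some j, i) * cnj ((dilation_matrix t *v v) $ (Some j, i)))
    = of_real (1/4) * (\<Sum>i\<in>UNIV. u $ i * cnj (v $ i)) + of_real (1/4) * (u $ j * cnj (v $ j))
      - of_real (t/9) * ((\<Sum>k\<in>UNIV. u $ k) * cnj (\<Sum>k\<in>UNIV. v $ k))"
proof -
  have pos: "dilation_scale j i \<noteq> 0" for i
    by (simp add: dilation_scale_def)
  have scale: "(dilation_scale j i)\<^sup>2 = (if i = j then 1/2 else 1/4)" for i
    by (simp add: dilation_scale_def)
  have "(\<Sum>i\<in>UNIV. 1 / (dilation_scale j i)\<^sup>2) = 10"
    using exhaust_3[of j] by (auto simp: scale sum_3)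
  moreover have "(dilation_shift t)\<^sup>2 * 10 - 2 * dilation_shift t = - t/9"
  proof -
    define r where "r = sqrt (1 - 10/9 * t)"
    have "r\<^sup>2 = 1 - 10/9 * t"
      using assms by (simp add: r_def)
    moreover have "((1 - r) / 10)\<^sup>2 * 10 - 2 * ((1 - r) / 10) = (r\<^sup>2 - 1) / 10"
      by (simp add: field_simps power2_eq_square)
    ultimately show ?thesis
      unfolding dilation_shift_def r_def[symmetric] by simp
  qed
  moreover have "(\<Sum>i\<in>UNIV. of_real ((dilation_scale j i)\<^sup>2) * (u $ i * cnj (v $ i)))
      = of_real (1/4) * (\<Sum>i\<in>UNIV. u $ i * cnj (v $ i)) + of_real (1/4) * (u $ j * cnj (v $ j))"
    using exhaust_3[of j] by (auto simp: scale sum_3 algebra_simps)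
  ultimately show ?thesis
    using rank_one_square_root[of "dilation_scale j" u "dilation_shift t" v, OF pos]
    by (simp add: dilation_matrix_nth)
qed

lemma affine_funD:
  assumes "a \<in> affine_fun K" "x \<in> K" "y \<in> K" "s \<in> {0..1}"
  shows "a ((1 - s) *\<^sub>R x + s *\<^sub>R y) = (1 - s) *\<^sub>R a x + s *\<^sub>R a y"
  using assms unfolding affine_fun_def by blast

lemma affine_fun_barycenter:
  assumes "a \<in> affine_fun std_triangle"
  shows "a barycenter = (1/3) *\<^sub>R (\<Sum>j\<in>UNIV. a (vertex j))"
proof -
  let ?m = "(1 - 1/2) *\<^sub>R vertex 1 + (1/2) *\<^sub>R vertex 2"
  have mid: "?m \<in> std_triangle"
    by (intro convexD[OF convex_std_triangle] vertex_in_std_triangle) auto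
  have "barycenter = (1 - 1/3) *\<^sub>R ?m + (1/3) *\<^sub>R vertex 3"
    by (simp add: barycenter_def scaleR_add_right)
  also have "a \<dots> = (1 - 1/3) *\<^sub>R a ?m + (1/3) *\<^sub>R a (vertex 3)"
    by (rule affine_funD[OF assms mid vertex_in_std_triangle]) auto
  also have "a ?m = (1 - 1/2) *\<^sub>R a (vertex 1) + (1/2) *\<^sub>R a (vertex 2)"
    by (rule affine_funD[OF assms vertex_in_std_triangle vertex_in_std_triangle]) auto
  finally show ?thesis
    by (simp add: sum_3 scaleR_add_right)
qed

lemma affine_fun_inner_pt:
  assumes "a \<in> affine_fun std_triangle"
  shows "a (inner_pt i) = (1/4) *\<^sub>R a (vertex i) + (3/4) *\<^sub>R a barycenter"
proof -
  have "inner_pt i = (1 - 3/4) *\<^sub>R vertex i + (3/4) *\<^sub>R barycenter"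
    by (simp add: inner_pt_eq)
  also have "a \<dots> = (1 - 3/4) *\<^sub>R a (vertex i) + (3/4) *\<^sub>R a barycenter"
    by (rule affine_funD[OF assms vertex_in_std_triangle barycenter_in_std_triangle]) auto
  finally show ?thesis
    by simp
qed

text \<open>
  An affine function is determined by its values \<open>\<alpha>\<^sub>j\<close> at the vertices. The contributions of the all-ones
  matrix cancel, because \<open>a(y)\<close> is the mean of the \<open>\<alpha>\<^sub>j\<close>; what remains is diagonal with entries
  \<open>(\<Sum>j. \<alpha>\<^sub>ja\<^sub>j(x\<^sub>i)) = a(x\<^sub>i)\<close>.
\<close>

lemma dilation_matrix_compress:
  assumes t: "0 \<le> t" "t \<le> 9/10" and a: "a \<in> affine_fun std_triangle"
  shows "(\<Sum>l\<in>UNIV. a (nu_point (fst l)) * ((dilation_matrix t *v u) $ l * cnj ((dilation_matrix t *v v) $ l)))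
    = (\<Sum>k\<in>UNIV. a (inner_pt k) * (u $ k * cnj (v $ k)))"
  unfolding sum_pair sum_option fst_conv nu_point_simps
  by (simp only: sum_distrib_left[symmetric] dilation_matrix_gram_barycenter[OF t(1)]
      dilation_matrix_gram_vertex[OF t(2)] affine_fun_inner_pt[OF a] affine_fun_barycenter[OF a])
     (simp add: sum_3 scaleR_conv_of_real field_simps)

text \<open>
  The cyclic vector is the unit vector \<open>\<xi>\<close> with equal entries. The matrices attached to the
  barycentre and to the vertices have expectation \<open>t\<close> and \<open>(1 - t)/3\<close> at \<open>\<xi>\<close>, which are the weights
  of \<open>\<nu>\<^sub>t\<close>.
\<close>

lemma dilation_le_mu_nu_if_le_nine_tenths:
  assumes t: "0 \<le> t" "t \<le> 9/10"
  shows "dilation_le TYPE('i \<Rightarrow> complex) std_triangle mu (nu t)"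
proof -
  obtain J :: "complex^3 \<Rightarrow> 'i \<Rightarrow> complex" where J: "inj J"
    using ex_inj_into_complex_functions by blast
  obtain J' :: "complex^(3 option \<times> 3) \<Rightarrow> 'i \<Rightarrow> complex" where J': "inj J'"
    using ex_inj_into_complex_functions by blast
  define z :: "complex^3" where "z = (\<chi> i. of_real (1 / sqrt 3))"
  have z_sq: "z $ i * cnj (z $ i) = of_real (1/3)" for i
    by (simp add: z_def flip: of_real_mult)
  have z_sum: "(\<Sum>k\<in>UNIV. z $ k) * cnj (\<Sum>k\<in>UNIV. z $ k) = of_real 3"
    using z_sq[of 1] by (simp add: z_def)
  show ?thesis
  proof (rule dilation_le_matrix[OF J J' mu_in_pos_measures nu_in_pos_measures range_inner_pt,
        where q = "nu_point \<circ> fst" and z = z and R = "dilation_matrix t"])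
    show "range (nu_point \<circ> fst) \<subseteq> std_triangle"
      using range_nu_point by auto
    fix f :: "real^3 \<Rightarrow> complex" assume f: "continuous_on std_triangle f"
    show "(\<integral>x. f x \<partial>mu) = (\<Sum>k\<in>UNIV. f (inner_pt k) * (z $ k * cnj (z $ k)))"
      by (simp add: integral_mu[OF f] z_sq scaleR_conv_of_real sum_distrib_left mult.commute)
    show "(\<integral>x. f x \<partial>nu t) = (\<Sum>l\<in>UNIV. f ((nu_point \<circ> fst) l) *
        ((dilation_matrix t *v z) $ l * cnj ((dilation_matrix t *v z) $ l)))"
      unfolding sum_pair sum_option fst_conv nu_point_simps comp_apply
      by (simp only: sum_distrib_left[symmetric] dilation_matrix_gram_barycenter[OF t(1)]
          dilation_matrix_gram_vertex[OF t(2)] z_sum z_sq)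
         (use t f in \<open>simp add: integral_nu scaleR_conv_of_real sum_3 field_simps\<close>)
  qed (use dilation_matrix_compress[OF t] in simp)
qed

section \<open>The two orders on the triangle\<close>

theorem theorem9p2:
  fixes t :: real
  assumes "t \<in> {0..1}"
  shows "(choquet_le std_triangle mu (nu t) \<longleftrightarrow> 0 \<le> t \<and> t \<le> 3/4) \<and>
    (dilation_le TYPE('i \<Rightarrow> complex) std_triangle mu (nu t) \<longleftrightarrow> 0 \<le> t \<and> t \<le> 9/10)"
proof (intro conjI)
  show "choquet_le std_triangle mu (nu t) \<longleftrightarrow> 0 \<le> t \<and> t \<le> 3/4"
    using choquet_le_mu_nu_iff[OF assms] assms by simp
  have "t \<le> 9/10" if "dilation_le TYPE('i \<Rightarrow> complex) std_triangle mu (nu t)"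
    using that unfolding dilation_le_def by (elim conjE exE) (rule dilation_imp_le_nine_tenths[OF assms])
  then show "dilation_le TYPE('i \<Rightarrow> complex) std_triangle mu (nu t) \<longleftrightarrow> 0 \<le> t \<and> t \<le> 9/10"
    using dilation_le_mu_nu_if_le_nine_tenths assms by auto
qed

end
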